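(* Let $\mathcal{P}$ be a hereditary property of ordered graphs, let $\mathcal{P}_n$ be the set of its members with vertex set $[n]$, and suppose that $|\mathcal{P}_m| < F_m$ for some $m \in \mathbb{N}$. Then there exist integers $K, N \geqslant 0$ and $a_0, \ldots, a_K \in \mathbb{Z}$ such that $|\mathcal{P}_n| = \sum_{i = 0}^K a_i \binom{n}{i}$ for every $n \geqslant N$.
   Context: An ordered graph is a graph with a linear order on its vertices; an ordered graph of order $n$ has vertex set $[n]$ with the natural order. Induced ordered subgraphs are given by injective order-preserving maps preserving adjacency and non-adjacency. A hereditary property of ordered graphs is a collection of ordered graphs closed under order-preserving isomorphism and under taking induced ordered subgraphs. $F_m$ denotes the Fibonacci number $F_{m,2}$, where $F_{n,2}=0$ for $n<0$, $F_{0,2}=1$, and $F_{n,2}=F_{n-1,2}+F_{n-2,2}$ for $n\geqslant 1$. *)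

theory Defs
  imports Main
begin

text \<open>An ordered graph of order n: vertex set {1..n} with the natural order;
  edges are 2-element subsets of {1..n}.  We represent it as the pair (n, E).\<close>

type_synonym ograph = "nat \<times> nat set set"

definition is_ograph :: "ograph \<Rightarrow> bool" where
  "is_ograph G \<longleftrightarrow>
     (\<forall>e\<in>snd G. \<exists>i j. 1 \<le> i \<and> i < j \<and> j \<le> fst G \<and> e = {i, j})"

definition induced_osub :: "ograph \<Rightarrow> ograph \<Rightarrow> bool" where
  "induced_osub H G \<longleftrightarrow>
     (\<exists>f. strict_mono_on {1..fst H} f \<and> f ` {1..fst H} \<subseteq> {1..fst G} \<and>
          (\<forall>i\<in>{1..fst H}. \<forall>j\<in>{1..fst H}. {i, j} \<in> snd H \<longleftrightarrow> {f i, f j} \<in> snd G))"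

text \<open>A hereditary property: a collection of ordered graphs closed under induced
  ordered subgraphs.  Since every ordered graph is represented canonically on [n],
  closure under order-preserving isomorphism is automatic.\<close>

definition hereditary :: "ograph set \<Rightarrow> bool" where
  "hereditary P \<longleftrightarrow>
     (\<forall>G\<in>P. is_ograph G) \<and>
     (\<forall>G\<in>P. \<forall>H. is_ograph H \<and> induced_osub H G \<longrightarrow> H \<in> P)"

definition slice :: "ograph set \<Rightarrow> nat \<Rightarrow> ograph set" where
  "slice P n = {G \<in> P. fst G = n}"

fun fibF :: "nat \<Rightarrow> nat" where
  "fibF 0 = 1"
| "fibF (Suc 0) = 1"
| "fibF (Suc (Suc n)) = fibF (Suc n) + fibF n"

end

theory Submission
  imports Defs "HOL-Library.Infinite_Set" "HOL-Library.Ramsey"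
begin

text \<open>Call p a break of an ordered graph if p and p + 1 are distinguished by a third vertex z.

  If members of P have arbitrarily many breaks, Ramsey's theorem yields long homogeneous sequences
  of triples (z, p, p + 1). In each of the resulting configurations one can encode the compositions of
  m into parts 1 and 2 (or all binary words of length m - 1) by induced subgraphs on m vertices that
  are pairwise distinct as labelled graphs, so P has at least as many members of order m as the
  Fibonacci number, for every m.

  Otherwise the number of breaks is bounded, and a graph is determined by the sizes of its boundedly
  many blocks of consecutive twins and the adjacencies within and between them. For a fixed
  adjacency pattern the occurring size vectors are closed under decrementing entries that are at
  least 3. By Dickson's lemma the slices of such a set are eventually constant, whence the number of
  its vectors of sum n is eventually a polynomial in n.\<close>

section \<open>Size vectors closed under decrements\<close>

text \<open>Ramsey's theorem fixes the needed adjacencies between different triples, and the break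
  supplies freedom inside a triple: \<open>z\<close> separates \<open>p\<close> from
  \<open>p + 1\<close>, so whatever default value homogeneity produces, one of the two vertices
  disagrees with it at \<open>z\<close>. A part 2 uses such an exceptional pair and a part 1 the
  default, so the first part in which two compositions differ is visible at a single pair of
  positions. In a star the same separation is read as a binary digit. Since order-preserving
  bijections of \<open>[m]\<close> are trivial, graphs that differ as labelled graphs are already
  different members of the property.\<close>

primrec poly_diff :: "nat \<Rightarrow> (nat \<Rightarrow> int) \<Rightarrow> bool" where
  "poly_diff 0 f \<longleftrightarrow> (\<exists>N. \<forall>n\<ge>N. f n = 0)"
| "poly_diff (Suc k) f \<longleftrightarrow> poly_diff k (\<lambda>n. f (Suc n) - f n)"

text \<open>Polynomials are represented only by the eventual vanishing of an iterated difference.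
  This makes sums, shifts and passing from a difference back to the function immediate; binomial
  coefficients are extracted once, at the end.\<close>

definition eventually_poly :: "(nat \<Rightarrow> int) \<Rightarrow> bool" where
  "eventually_poly f \<longleftrightarrow> (\<exists>k. poly_diff k f)"

lemma poly_diff_cong:
  "poly_diff k f \<Longrightarrow> (\<And>n. n \<ge> N \<Longrightarrow> f n = g n) \<Longrightarrow> poly_diff k g"
proof (induction k arbitrary: f g)
  case 0
  then obtain M where "\<forall>n\<ge>M. f n = 0" by auto
  then have "\<forall>n\<ge>max M N. g n = 0" using 0 by (metis max.boundedE)
  then show ?case unfolding poly_diff.simps by blast
next
  case (Suc k)
  show ?case using Suc.IH[of "\<lambda>n. f (Suc n) - f n" "\<lambda>n. g (Suc n) - g n"] Suc.prems by simp
qed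

lemma poly_diff_Suc: "poly_diff k f \<Longrightarrow> poly_diff (Suc k) f"
proof (induction k arbitrary: f)
  case 0
  then obtain N where "\<forall>n\<ge>N. f n = 0" by auto
  then have "\<forall>n\<ge>N. f (Suc n) - f n = 0" by simp
  then show ?case unfolding poly_diff.simps by blast
next
  case (Suc k)
  from Suc.prems have "poly_diff k (\<lambda>n. f (Suc n) - f n)" by simp
  from Suc.IH[OF this] show ?case by simp
qed

lemma poly_diff_mono: "poly_diff k f \<Longrightarrow> k \<le> l \<Longrightarrow> poly_diff l f"
  by (induction l) (auto simp: le_Suc_eq intro: poly_diff_Suc simp del: poly_diff.simps)

lemma poly_diff_linear:
  "poly_diff k f \<Longrightarrow> poly_diff k g \<Longrightarrow> poly_diff k (\<lambda>n. f n + c * g n)"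
proof (induction k arbitrary: f g)
  case 0
  then obtain M N where "\<forall>n\<ge>M. f n = 0" "\<forall>n\<ge>N. g n = 0" by auto
  then have "\<forall>n\<ge>max M N. f n + c * g n = 0" by auto
  then show ?case unfolding poly_diff.simps by blast
next
  case (Suc k)
  have "poly_diff k (\<lambda>n. (f (Suc n) - f n) + c * (g (Suc n) - g n))"
    using Suc by simp
  then show ?case by (simp add: algebra_simps)
qed

lemma poly_diff_shift: "poly_diff k f \<Longrightarrow> poly_diff k (\<lambda>n. f (n - j))"
proof (induction k arbitrary: f)
  case 0
  then obtain N where "\<forall>n\<ge>N. f n = 0" by auto
  then have "\<forall>n\<ge>N + j. f (n - j) = 0" by auto
  then show ?case unfolding poly_diff.simps by blast
next
  case (Suc k)
  from Suc.prems have "poly_diff k (\<lambda>n. f (Suc n) - f n)" by simp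
  from Suc.IH[OF this] have "poly_diff k (\<lambda>n. f (Suc (n - j)) - f (n - j))" .
  \<comment> \<open>For \<open>n < j\<close> the truncated subtraction gives
    \<open>Suc (n - j) = 1\<close> but \<open>Suc n - j = 0\<close>, so the two functions are
    compared only from \<open>j\<close> on.\<close>
  then have "poly_diff k (\<lambda>n. f (Suc n - j) - f (n - j))"
    by (rule poly_diff_cong[where N = j]) (simp add: Suc_diff_le)
  then show ?case by simp
qed

text \<open>The value \<open>f (Suc n)\<close> is \<open>f n\<close> plus the difference at
  \<open>n\<close>, and \<open>poly_diff_Suc\<close> gives that difference the same bound
  \<open>k\<close>.\<close>

lemma poly_diff_unshift: "poly_diff k f \<Longrightarrow> poly_diff k (\<lambda>n. f (Suc n))"
  using poly_diff_linear[of "Suc k" f f 0] poly_diff_linear[of k f "\<lambda>n. f (Suc n) - f n" 1] poly_diff_Suc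
  by simp

lemma eventually_poly_linear:
  assumes "eventually_poly f" "eventually_poly g"
  shows "eventually_poly (\<lambda>n. f n + c * g n)"
proof -
  from assms obtain k l where "poly_diff k f" "poly_diff l g"
    unfolding eventually_poly_def by blast
  then have "poly_diff (max k l) f" "poly_diff (max k l) g"
    by (auto intro: poly_diff_mono)
  then show ?thesis unfolding eventually_poly_def by (blast intro: poly_diff_linear)
qed

lemma eventually_poly_diff:
  "eventually_poly f \<Longrightarrow> eventually_poly g \<Longrightarrow> eventually_poly (\<lambda>n. f n - g n)"
  using eventually_poly_linear[of f g "-1"] by simp

lemma eventually_poly_zero: "eventually_poly (\<lambda>n. 0)"
  unfolding eventually_poly_def by (rule exI[of _ 0]) simp

lemma eventually_poly_sum:
  "finite A \<Longrightarrow> (\<And>x. x \<in> A \<Longrightarrow> eventually_poly (f x)) \<Longrightarrow> eventually_poly (\<lambda>n. \<Sum>x\<in>A. f x n)"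
proof (induction A rule: finite_induct)
  case (insert x A)
  then have "eventually_poly (\<lambda>n. f x n + 1 * (\<Sum>x\<in>A. f x n))"
    by (intro eventually_poly_linear) auto
  with insert show ?case by simp
qed (simp add: eventually_poly_zero)

text \<open>By Pascal's rule \<open>n choose Suc i\<close> has difference \<open>n choose i\<close>.
  Summing a binomial expansion therefore raises every lower index by one, and the constant
  \<open>c\<close> is fixed by the value at \<open>N\<close>.\<close>

lemma poly_diff_binomial:
  "poly_diff k f \<Longrightarrow> \<exists>K N a. \<forall>n\<ge>N. f n = (\<Sum>i\<le>K. a i * int (n choose i))"
proof (induction k arbitrary: f)
  case 0
  then obtain N where "\<forall>n\<ge>N. f n = 0" by auto
  then show ?case by (intro exI[of _ 0] exI[of _ N] exI[of _ "\<lambda>i. 0"]) simp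
next
  case (Suc k)
  from Suc.prems have "poly_diff k (\<lambda>n. f (Suc n) - f n)" by simp
  from Suc.IH[OF this] obtain K N a
    where D: "\<And>n. n \<ge> N \<Longrightarrow> f (Suc n) - f n = (\<Sum>i\<le>K. a i * int (n choose i))"
    by blast
  define c where "c = f N - (\<Sum>i\<le>K. a i * int (N choose Suc i))"
  have "f n = c + (\<Sum>i\<le>K. a i * int (n choose Suc i))" if "n \<ge> N" for n
    using that
  proof (induction n rule: dec_induct)
    case (step n)
    then show ?case using D[of n]
      by (simp add: distrib_left sum.distrib algebra_simps)
  qed (simp add: c_def)
  then have "\<forall>n\<ge>N. f n = (\<Sum>i\<le>Suc K. (case i of 0 \<Rightarrow> c | Suc i \<Rightarrow> a i) * int (n choose i))"
    by (simp add: sum.atMost_Suc_shift del: sum.atMost_Suc binomial_Suc_Suc)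
  then show ?case by blast
qed

section \<open>A well-quasi-order on size vectors\<close>

text \<open>Entries 0 and 1 are comparable only to themselves: a block loses its type information when it
  shrinks below two vertices, so sizes are compared only from 2 on.\<close>

definition dom_le :: "nat \<Rightarrow> nat \<Rightarrow> bool" where
  "dom_le x y \<longleftrightarrow> x = y \<or> 2 \<le> x \<and> x \<le> y"

text \<open>If some value recurs infinitely often, its positions give a constant subsequence, the
  only kind available for the values 0 and 1. Otherwise each bound is exceeded arbitrarily late, and
  a nondecreasing subsequence with entries at least 2 is picked greedily.\<close>

lemma dom_le_subseq:
  fixes f :: "nat \<Rightarrow> nat"
  obtains r :: "nat \<Rightarrow> nat" where "strict_mono r" "\<And>i j. i < j \<Longrightarrow> dom_le (f (r i)) (f (r j))"
proof (cases "\<exists>v. infinite {n. f n = v}")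
  case True
  then obtain v where v: "infinite {n. f n = v}" by blast
  have "f (enumerate {n. f n = v} i) = v" for i
    using enumerate_in_set[OF v, of i] by simp
  then show ?thesis
    by (intro that[of "enumerate {n. f n = v}"])
       (auto simp: strict_mono_enumerate[OF v] dom_le_def)
next
  case False
  have "{n. f n \<le> M} = (\<Union>v\<le>M. {n. f n = v})" for M by auto
  with False have fin: "finite {n. f n \<le> M}" for M by simp
  have big: "\<exists>n>x. f n > M" for M x
  proof -
    have "finite ({n. f n \<le> M} \<union> {..x})" using fin by simp
    then obtain n where "n \<notin> {n. f n \<le> M} \<union> {..x}"
      using ex_new_if_finite[OF infinite_UNIV_nat] by blast
    then show ?thesis by (intro exI[of _ n]) auto
  qed
  have "\<exists>r. \<forall>n. 2 \<le> f (r n) \<and> (r n < r (Suc n) \<and> f (r n) \<le> f (r (Suc n)))"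
  proof (rule dependent_nat_choice)
    show "\<exists>x. 2 \<le> f x" using big[of 0 2] by (meson less_imp_le)
  next
    fix x n :: nat assume x: "2 \<le> f x"
    obtain y where "y > x" "f y > f x" using big by blast
    with x show "\<exists>y. 2 \<le> f y \<and> x < y \<and> f x \<le> f y" by (intro exI[of _ y]) auto
  qed
  then obtain r where r: "\<And>n. 2 \<le> f (r n)" "\<And>n. r n < r (Suc n)" "\<And>n. f (r n) \<le> f (r (Suc n))"
    by blast
  have "strict_mono r" using r(2) by (simp add: strict_mono_Suc_iff)
  moreover have "f (r i) \<le> f (r j)" if "i < j" for i j
    using lift_Suc_mono_le[of "\<lambda>n. f (r n)" i j] r(3) that by simp
  ultimately show ?thesis using r(1) by (intro that) (auto simp: dom_le_def)
qed

text \<open>A subsequence that is good for the heads is thinned out further to be good for the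
  tails, by induction on the length.\<close>

lemma dom_le_dickson:
  fixes f :: "nat \<Rightarrow> nat list"
  assumes "\<And>n. length (f n) = b"
  shows "\<exists>r :: nat \<Rightarrow> nat. strict_mono r \<and> (\<forall>i j. i < j \<longrightarrow> list_all2 dom_le (f (r i)) (f (r j)))"
  using assms
proof (induction b arbitrary: f)
  case 0
  then have nil: "f n = []" for n by simp
  show ?case by (rule exI[of _ id]) (simp add: strict_mono_def nil)
next
  case (Suc b)
  have f: "f n = hd (f n) # tl (f n)" for n using Suc.prems[of n] by (cases "f n") auto
  obtain r :: "nat \<Rightarrow> nat"
    where r: "strict_mono r" "\<And>i j. i < j \<Longrightarrow> dom_le (hd (f (r i))) (hd (f (r j)))"
    by (rule dom_le_subseq[of "\<lambda>n. hd (f n)"]) blast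
  obtain q :: "nat \<Rightarrow> nat"
    where q: "strict_mono q" "\<And>i j. i < j \<Longrightarrow> list_all2 dom_le (tl (f (r (q i)))) (tl (f (r (q j))))"
    using Suc.IH[of "\<lambda>n. tl (f (r n))"] Suc.prems by auto
  have "list_all2 dom_le (f (r (q i))) (f (r (q j)))" if "i < j" for i j
    using r(2)[of "q i" "q j"] q that f[of "r (q i)"] f[of "r (q j)"]
    by (metis list_all2_Cons strict_mono_less)
  moreover have "strict_mono (r \<circ> q)" using r(1) q(1) by (simp add: strict_mono_def)
  ultimately show ?case unfolding o_def by blast
qed

text \<open>An entry where \<open>t\<close> differs from \<open>s\<close> satisfies
  \<open>2 \<le> s ! i\<close> and \<open>s ! i < t ! i\<close>, so it is at least 3 and can be
  lowered without leaving \<open>S\<close> or falling below \<open>s\<close>. The sum decreases, so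
  this ends at \<open>s\<close>.\<close>

lemma decrement_closed_dom_le:
  assumes closed: "\<And>s i. s \<in> S \<Longrightarrow> i < length s \<Longrightarrow> 3 \<le> s ! i \<Longrightarrow> s[i := s ! i - 1] \<in> S"
  shows "t \<in> S \<Longrightarrow> list_all2 dom_le s t \<Longrightarrow> s \<in> S"
proof (induction "sum_list t" arbitrary: t rule: less_induct)
  case less
  show ?case
  proof (cases "s = t")
    case False
    then obtain i where i: "i < length t" "s ! i \<noteq> t ! i"
      using less.prems(2) by (metis list_all2_lengthD nth_equalityI)
    with less.prems(2) have si: "2 \<le> s ! i" "s ! i < t ! i"
      unfolding list_all2_conv_all_nth dom_le_def by force+
    let ?t = "t[i := t ! i - 1]"
    have "?t \<in> S" using closed less.prems(1) i si by simp
    moreover have "list_all2 dom_le s ?t"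
      using less.prems(2) si i unfolding list_all2_conv_all_nth
      by (auto simp: nth_list_update dom_le_def)
    moreover have "sum_list ?t < sum_list t"
      using i si elem_le_sum_list[of i t] by (simp add: sum_list_update)
    ultimately show ?thesis using less.hyps by blast
  qed (use less in simp)
qed

lemma finite_lists_sum: "finite {s :: nat list. length s = b \<and> sum_list s = n}"
proof (rule finite_subset)
  show "{s. length s = b \<and> sum_list s = n} \<subseteq> {s. set s \<subseteq> {..n} \<and> length s = b}"
    using member_le_sum_list by fastforce
qed (simp add: finite_lists_length_eq)

text \<open>Fixing the first entry \<open>j\<close> leaves a set \<open>T j\<close> of vectors of
  length \<open>b\<close>, covered by induction. These sets shrink from \<open>j = 2\<close> on and
  are constant from some \<open>J\<close>; in the difference of the counting function all terms from
  \<open>J\<close> on cancel, which leaves a fixed finite number of eventually polynomial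
  terms.\<close>

lemma decrement_closed_eventually_poly:
  assumes "\<And>s. s \<in> S \<Longrightarrow> length s = b"
    and "\<And>s i. s \<in> S \<Longrightarrow> i < b \<Longrightarrow> 3 \<le> s ! i \<Longrightarrow> s[i := s ! i - 1] \<in> S"
  shows "eventually_poly (\<lambda>n. int (card {s \<in> S. sum_list s = n}))"
  using assms
proof (induction b arbitrary: S)
  case 0
  then have E: "{s \<in> S. sum_list s = n} = {}" if "n \<ge> 1" for n using that by fastforce
  have "\<forall>n\<ge>1. int (card {s \<in> S. sum_list s = n}) = 0"
    by (intro allI impI) (simp only: E card.empty of_nat_0)
  then have "poly_diff 0 (\<lambda>n. int (card {s \<in> S. sum_list s = n}))"
    unfolding poly_diff.simps by blast
  then show ?case unfolding eventually_poly_def by blast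
next
  case (Suc b)
  define T where "T j = {t. j # t \<in> S}" for j
  have T_len: "length t = b" if "t \<in> T j" for t j using that Suc.prems(1)[of "j # t"] by (simp add: T_def)
  have T_closed: "t[i := t ! i - 1] \<in> T j" if "t \<in> T j" "i < length t" "3 \<le> t ! i" for t i j
    using Suc.prems(2)[of "j # t" "Suc i"] that T_len[OF that(1)] by (simp add: T_def)
  have T_dec: "T (Suc j) \<subseteq> T j" if "j \<ge> 2" for j
    using Suc.prems(2)[of "Suc j # t" 0 for t] that by (auto simp: T_def)
  have T_anti: "T j \<subseteq> T i" if "2 \<le> i" "i \<le> j" for i j
    using that(2)
  proof (induction j rule: dec_induct)
    case (step j)
    then show ?case using T_dec[of j] that(1) by simp
  qed simp
  obtain J where J: "\<And>j. j \<ge> J \<Longrightarrow> T (Suc j) = T j"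
  proof -
    define X where "X = {j. j \<ge> 2 \<and> T (Suc j) \<noteq> T j}"
    have "finite X"
    proof (rule ccontr)
      \<comment> \<open>Each strict drop from \<open>T (e i)\<close> to \<open>T (Suc (e i))\<close>
        loses some vector \<open>t i\<close>. Of two comparable lost vectors the later one still
        belongs to the set after the earlier drop, so by downward closure the earlier one does
        too.\<close>
      assume inf: "infinite X"
      define e where "e = enumerate X"
      have e: "e i \<ge> 2" "T (Suc (e i)) \<noteq> T (e i)" for i
        using enumerate_in_set[OF inf, of i] by (auto simp: e_def X_def)
      have "\<exists>t. t \<in> T (e i) \<and> t \<notin> T (Suc (e i))" for i using e[of i] T_dec[of "e i"] by blast
      then obtain t where t: "\<And>i. t i \<in> T (e i)" "\<And>i. t i \<notin> T (Suc (e i))" by metis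
      obtain r :: "nat \<Rightarrow> nat"
        where r: "strict_mono r" "\<And>i j. i < j \<Longrightarrow> list_all2 dom_le (t (r i)) (t (r j))"
        using dom_le_dickson[of t b] t(1) T_len by metis
      have "r 0 < r 1" using r(1) by (simp add: strict_mono_def)
      then have "e (r 0) < e (r 1)"
        using strict_mono_enumerate[OF inf] by (simp add: e_def strict_mono_def)
      then have "t (r 1) \<in> T (Suc (e (r 0)))"
        using T_anti[of "Suc (e (r 0))" "e (r 1)"] e(1)[of "r 0"] t(1)[of "r 1"] by auto
      then have "t (r 0) \<in> T (Suc (e (r 0)))"
        by (rule decrement_closed_dom_le[rotated]) (use r(2)[of 0 1] T_closed in auto)
      with t(2) show False by blast
    qed
    then obtain M where "\<forall>x\<in>X. x < M" by (auto simp: finite_nat_set_iff_bounded)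
    then have "T (Suc j) = T j" if "j \<ge> max 2 M" for j using that by (force simp: X_def)
    then show ?thesis by (rule that)
  qed
  define c where "c j n = int (card {t \<in> T j. sum_list t = n})" for j n
  have c_poly: "eventually_poly (c j)" for j
    unfolding c_def by (rule Suc.IH) (use T_len T_closed in auto)
  define F where "F n = int (card {s \<in> S. sum_list s = n})" for n
  have F: "F n = (\<Sum>j\<le>n. c j (n - j))" for n
  proof -
    have "{s \<in> S. sum_list s = n} = (\<Union>j\<le>n. (#) j ` {t \<in> T j. sum_list t = n - j})"
    proof (intro subset_antisym subsetI)
      fix s assume s: "s \<in> {s \<in> S. sum_list s = n}"
      then obtain j t where "s = j # t" using Suc.prems(1)[of s] by (cases s) auto
      with s have "j \<le> n" "t \<in> {t \<in> T j. sum_list t = n - j}" by (auto simp: T_def)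
      with \<open>s = j # t\<close> show "s \<in> (\<Union>j\<le>n. (#) j ` {t \<in> T j. sum_list t = n - j})" by blast
    qed (auto simp: T_def)
    moreover have "finite {t \<in> T j. sum_list t = k}" for j k
      by (rule finite_subset[OF _ finite_lists_sum[of b k]]) (use T_len in auto)
    moreover have "card ((#) j ` {t \<in> T j. sum_list t = n - j}) = card {t \<in> T j. sum_list t = n - j}" for j
      by (rule card_image) simp
    ultimately have "card {s \<in> S. sum_list s = n} = (\<Sum>j\<le>n. card {t \<in> T j. sum_list t = n - j})"
      by (subst (1) \<open>_ = \<Union> _\<close>, subst card_UN_disjoint) auto
    then show ?thesis by (simp add: F_def c_def)
  qed
  \<comment> \<open>Splitting off index 0 in \<open>F (Suc n)\<close> and shifting the rest pairs
    \<open>c (Suc j)\<close> with \<open>c j\<close> at the same argument \<open>n - j\<close>. The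
    bound \<open>n \<ge> J\<close> puts \<open>{..<J}\<close> inside the range of summation.\<close>
  have DF: "F (Suc n) - F n = c 0 (Suc n) + (\<Sum>j<J. c (Suc j) (n - j) - c j (n - j))" if "n \<ge> J" for n
  proof -
    have "F (Suc n) - F n = c 0 (Suc n) + (\<Sum>j\<le>n. c (Suc j) (n - j) - c j (n - j))"
      unfolding F by (simp add: sum.atMost_Suc_shift sum_subtractf del: sum.atMost_Suc)
    also have "(\<Sum>j\<le>n. c (Suc j) (n - j) - c j (n - j)) = (\<Sum>j<J. c (Suc j) (n - j) - c j (n - j))"
      by (rule sum.mono_neutral_right) (use that J in \<open>auto simp: c_def\<close>)
    finally show ?thesis .
  qed
  have unshift: "eventually_poly (\<lambda>n. f (Suc n))" "eventually_poly (\<lambda>n. f (n - j))"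
    if "eventually_poly f" for f j
    using that poly_diff_shift poly_diff_unshift unfolding eventually_poly_def by blast+
  have "eventually_poly (\<lambda>n. c 0 (Suc n) + 1 * (\<Sum>j<J. c (Suc j) (n - j) - c j (n - j)))"
    by (intro eventually_poly_linear eventually_poly_sum eventually_poly_diff unshift c_poly) simp
  then obtain k where "poly_diff k (\<lambda>n. c 0 (Suc n) + (\<Sum>j<J. c (Suc j) (n - j) - c j (n - j)))"
    unfolding eventually_poly_def by auto
  then have "poly_diff k (\<lambda>n. F (Suc n) - F n)"
    by (rule poly_diff_cong[where N = J]) (simp add: DF)
  then have "poly_diff (Suc k) F" by simp
  then show ?case unfolding eventually_poly_def F_def by blast
qed

section \<open>Graphs with boundedly many breaks\<close>

definition adj :: "ograph \<Rightarrow> nat \<Rightarrow> nat \<Rightarrow> bool" where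
  "adj G u v \<longleftrightarrow> {u, v} \<in> snd G"

lemma adj_commute: "adj G u v = adj G v u"
  by (simp add: adj_def insert_commute)

lemma is_ograph_eqI:
  assumes "is_ograph G" "is_ograph H" "fst G = fst H"
    and "\<And>u v. 1 \<le> u \<Longrightarrow> u < v \<Longrightarrow> v \<le> fst G \<Longrightarrow> adj G u v \<longleftrightarrow> adj H u v"
  shows "G = H"
proof -
  have "e \<in> snd H"
    if G: "is_ograph G" "fst G = fst H" "e \<in> snd G" and eq:
      "\<And>u v. 1 \<le> u \<Longrightarrow> u < v \<Longrightarrow> v \<le> fst G \<Longrightarrow> adj G u v \<longleftrightarrow> adj H u v" for G H e
  proof -
    obtain u v where uv: "1 \<le> u" "u < v" "v \<le> fst G" "e = {u, v}"
      using G unfolding is_ograph_def by blast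
    with G(3) eq[OF uv(1-3)] show ?thesis by (simp add: adj_def)
  qed
  from this[OF assms(1,3)] this[OF assms(2) assms(3)[symmetric]] assms(3,4)
  have "snd G = snd H" by auto
  with assms(3) show ?thesis by (simp add: prod_eq_iff)
qed

lemma finite_ographs: "finite {G. is_ograph G \<and> fst G = n}"
proof (rule finite_subset)
  show "{G. is_ograph G \<and> fst G = n} \<subseteq> {n} \<times> Pow (Pow {1..n})"
    unfolding is_ograph_def by fastforce
qed simp

lemma finite_slice: "hereditary P \<Longrightarrow> finite (slice P n)"
  by (rule finite_subset[OF _ finite_ographs[of n]]) (auto simp: slice_def hereditary_def)

section \<open>Breaks and homogeneous blocks\<close>

text \<open>Positions p where p and p + 1 are not twins. Maximal break-free intervals are homogeneous.\<close>

definition breaks :: "ograph \<Rightarrow> nat set" where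
  "breaks G = {p. 1 \<le> p \<and> p < fst G \<and>
     (\<exists>z\<in>{1..fst G} - {p, Suc p}. adj G z p \<noteq> adj G z (Suc p))}"

text \<open>Blocks are numbered from 0. Only breaks strictly below \<open>v\<close> count, so a
  break is the last vertex of its block.\<close>

definition block :: "ograph \<Rightarrow> nat \<Rightarrow> nat" where
  "block G v = card {p \<in> breaks G. p < v}"

lemma finite_breaks [simp]: "finite (breaks G)"
  by (rule finite_subset[of _ "{..fst G}"]) (auto simp: breaks_def)

lemma block_1: "block G (Suc 0) = 0"
  by (auto simp: block_def breaks_def)

lemma block_Suc: "block G (Suc v) = block G v + (if v \<in> breaks G then 1 else 0)"
proof -
  have "{p \<in> breaks G. p < Suc v} = {p \<in> breaks G. p < v} \<union> (if v \<in> breaks G then {v} else {})"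
    by (auto simp: less_Suc_eq)
  then show ?thesis by (simp add: block_def)
qed

lemma block_mono: "u \<le> v \<Longrightarrow> block G u \<le> block G v"
  unfolding block_def by (intro card_mono) auto

lemma block_le: "block G v \<le> card (breaks G)"
  unfolding block_def by (intro card_mono) auto

text \<open>No position from \<open>u\<close> up to \<open>u' - 1\<close> is a break, and
  \<open>z\<close> lies outside the interval, so it is never one of the two consecutive vertices
  compared.\<close>

lemma adj_block_eq:
  assumes "1 \<le> u" "u \<le> u'" "u' \<le> fst G" "block G u = block G u'"
    and z: "z \<in> {1..fst G}" "z < u \<or> u' < z"
  shows "adj G z u = adj G z u'"
  using assms(2,3,4) z(2)
proof (induction u' rule: dec_induct)
  case (step w)
  have "block G u = block G w" "w \<notin> breaks G"
    using block_mono[of u w G] block_Suc[of G w] step by (auto split: if_splits)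
  moreover have "adj G z w = adj G z (Suc w)"
    using \<open>w \<notin> breaks G\<close> step assms(1) z(1) unfolding breaks_def by auto
  ultimately show ?case using step by auto
qed simp

text \<open>One endpoint is moved at a time, \<open>v\<close> to \<open>v'\<close> and then
  \<open>u\<close> to \<open>u'\<close>. Starting from the pair with the smaller left end keeps the
  fixed endpoint outside the interval traversed, also when all four vertices lie in one
  block.\<close>

lemma adj_block_homogeneous:
  assumes "1 \<le> u" "u < v" "v \<le> n" "1 \<le> u'" "u' < v'" "v' \<le> n" "fst G = n"
    and "block G u = block G u'" "block G v = block G v'"
  shows "adj G u v = adj G u' v'"
proof -
  have *: "adj G u v = adj G u' v'"
    if "1 \<le> u" "u < v" "v \<le> n" "u \<le> u'" "u' < v'" "v' \<le> n"
      "block G u = block G u'" "block G v = block G v'" for u v u' v'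
  proof -
    have "adj G u v = adj G u v'"
    proof (cases "v \<le> v'")
      case True
      then show ?thesis using that assms(7) by (intro adj_block_eq) auto
    next
      case False
      then have "adj G u v' = adj G u v" using that assms(7) by (intro adj_block_eq) auto
      then show ?thesis by simp
    qed
    also have "\<dots> = adj G v' u'"
      using that assms(7) by (subst adj_commute) (intro adj_block_eq, auto)
    finally show ?thesis by (simp add: adj_commute)
  qed
  show ?thesis
  proof (cases "u \<le> u'")
    case True
    with assms show ?thesis by (intro *) auto
  next
    case False
    with assms have "adj G u' v' = adj G u v" by (intro *) auto
    then show ?thesis by simp
  qed
qed

section \<open>Reconstruction of a graph from block sizes and adjacency pattern\<close>

text \<open>By homogeneity, \<open>(i, j)\<close> with \<open>i < j\<close> says that two blocks are
  completely joined, and \<open>(i, i)\<close> that block \<open>i\<close> is a clique on at least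
  two vertices. A one-vertex block contributes no \<open>(i, i)\<close>, which is why deletions are
  made only in blocks that keep two vertices.\<close>

definition core :: "ograph \<Rightarrow> (nat \<times> nat) set" where
  "core G = {(block G u, block G v) | u v. 1 \<le> u \<and> u < v \<and> v \<le> fst G \<and> adj G u v}"

text \<open>The list is padded with zeros to the common length \<open>b\<close>, so that graphs with
  different numbers of blocks give vectors in the same space.\<close>

definition sizes :: "nat \<Rightarrow> ograph \<Rightarrow> nat list" where
  "sizes b G = map (\<lambda>i. card {v \<in> {1..fst G}. block G v = i}) [0..<b]"

lemma adj_iff_core:
  assumes "1 \<le> u" "u < v" "v \<le> fst G"
  shows "adj G u v \<longleftrightarrow> (block G u, block G v) \<in> core G"
proof
  assume "(block G u, block G v) \<in> core G"
  then obtain u' v' where "1 \<le> u'" "u' < v'" "v' \<le> fst G" "adj G u' v'"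
    "block G u = block G u'" "block G v = block G v'"
    unfolding core_def by auto
  then show "adj G u v" using adj_block_homogeneous[OF assms, of u' v' G] by simp
qed (use assms in \<open>auto simp: core_def\<close>)

lemma card_block_less:
  assumes "i \<le> b"
  shows "card {v \<in> {1..fst G}. block G v < i} = sum_list (take i (sizes b G))"
proof -
  have "{v \<in> {1..fst G}. block G v < i} = (\<Union>j<i. {v \<in> {1..fst G}. block G v = j})" by auto
  then have "card {v \<in> {1..fst G}. block G v < i} = (\<Sum>j<i. card {v \<in> {1..fst G}. block G v = j})"
    by (simp only:) (subst card_UN_disjoint, auto)
  also have "\<dots> = sum_list (take i (sizes b G))"
    using assms by (simp add: sizes_def take_map sum_list_distinct_conv_sum_set atLeast0LessThan)
  finally show ?thesis .
qed

lemma sum_list_sizes: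
  assumes "card (breaks G) < b"
  shows "sum_list (sizes b G) = fst G"
proof -
  have "{v \<in> {1..fst G}. block G v < b} = {1..fst G}"
    using assms block_le[of G] by (auto intro: le_less_trans)
  with card_block_less[of b b G] show ?thesis by (simp add: sizes_def)
qed

text \<open>Block numbers are nondecreasing along the order, so the vertices in blocks below
  \<open>i\<close> form an initial segment, whose length is a partial sum of the sizes.\<close>

lemma block_less_iff:
  assumes "1 \<le> v" "v \<le> fst G" "i \<le> b"
  shows "block G v < i \<longleftrightarrow> v \<le> sum_list (take i (sizes b G))"
proof
  assume "block G v < i"
  then have "{1..v} \<subseteq> {v \<in> {1..fst G}. block G v < i}"
    using assms(2) le_less_trans[OF block_mono[of _ v G]] by auto
  then have "card {1..v} \<le> card {v \<in> {1..fst G}. block G v < i}"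
    by (intro card_mono) auto
  then show "v \<le> sum_list (take i (sizes b G))" using card_block_less[OF assms(3)] by simp
next
  assume v: "v \<le> sum_list (take i (sizes b G))"
  show "block G v < i"
  proof (rule ccontr)
    assume "\<not> block G v < i"
    then have "{v \<in> {1..fst G}. block G v < i} \<subseteq> {1..<v}"
      using block_mono[of v _ G] by (auto simp: not_less) (metis leI le_less_trans less_le_not_le)
    then have "card {v \<in> {1..fst G}. block G v < i} \<le> card {1..<v}"
      by (intro card_mono) auto
    then show False using card_block_less[OF assms(3), of G] v assms(1) by simp
  qed
qed

text \<open>Partial sums of the sizes recover the block of each vertex, and \<open>core\<close> then
  decides every adjacency.\<close>

lemma sizes_core_inj:
  assumes G: "is_ograph G" "card (breaks G) < b" and H: "is_ograph H" "card (breaks H) < b"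
    and eq: "sizes b G = sizes b H" "core G = core H"
  shows "G = H"
proof -
  have n: "fst G = fst H" using sum_list_sizes[OF G(2)] sum_list_sizes[OF H(2)] eq by simp
  have bl: "block G v = block H v" if "1 \<le> v" "v \<le> fst G" for v
  proof -
    have "block G v < i \<longleftrightarrow> block H v < i" if "i \<le> b" for i
      using block_less_iff[of v G i b] block_less_iff[of v H i b] \<open>1 \<le> v\<close> \<open>v \<le> fst G\<close> that n eq
      by simp
    moreover have "Suc (block G v) \<le> b" "Suc (block H v) \<le> b"
      using block_le[of G v] block_le[of H v] G H by auto
    ultimately show ?thesis by (metis lessI less_Suc_eq_le nle_le)
  qed
  show ?thesis
    using adj_iff_core[of _ _ G] adj_iff_core[of _ _ H] bl eq n
    by (intro is_ograph_eqI G H n) auto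
qed

section \<open>Deletion of a vertex\<close>

text \<open>For \<open>w\<close> in \<open>{1..n}\<close> this is the increasing bijection from
  \<open>{1..n - 1}\<close> onto \<open>{1..n} - {w}\<close>.\<close>

definition skip :: "nat \<Rightarrow> nat \<Rightarrow> nat" where
  "skip w u = (if u < w then u else Suc u)"

definition delete_vertex :: "ograph \<Rightarrow> nat \<Rightarrow> ograph" where
  "delete_vertex G w = (fst G - 1,
     {{u, v} | u v. 1 \<le> u \<and> u < v \<and> v \<le> fst G - 1 \<and> adj G (skip w u) (skip w v)})"

lemma fst_delete_vertex [simp]: "fst (delete_vertex G w) = fst G - 1"
  by (simp add: delete_vertex_def)

lemma is_ograph_delete_vertex: "is_ograph (delete_vertex G w)"
  unfolding is_ograph_def delete_vertex_def by auto

lemma skip_less_iff [simp]: "skip w u < skip w v \<longleftrightarrow> u < v"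
  by (auto simp: skip_def)

lemma skip_neq [simp]: "skip w u \<noteq> w"
  by (auto simp: skip_def)

lemma skip_le: "u \<le> n - 1 \<Longrightarrow> 1 \<le> u \<Longrightarrow> skip w u \<le> n"
  by (auto simp: skip_def)

lemma skip_ge: "1 \<le> u \<Longrightarrow> 1 \<le> skip w u"
  by (auto simp: skip_def)

lemma skip_surj:
  assumes "1 \<le> v" "v \<le> n" "v \<noteq> w" "1 \<le> w" "w \<le> n"
  obtains u where "1 \<le> u" "u \<le> n - 1" "v = skip w u"
  using that[of v] that[of "v - 1"] assms by (cases "v < w") (auto simp: skip_def)

lemma adj_delete_vertex:
  assumes "1 \<le> u" "1 \<le> v" "u \<le> fst G - 1" "v \<le> fst G - 1" "u \<noteq> v"
  shows "adj (delete_vertex G w) u v = adj G (skip w u) (skip w v)"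
proof -
  have "adj (delete_vertex G w) u v = adj G (skip w u) (skip w v)"
    if "1 \<le> u" "v \<le> fst G - 1" "u < v" for u v
    using that unfolding adj_def delete_vertex_def by (auto simp: doubleton_eq_iff)
  from this[of u v] this[of v u] assms show ?thesis
    by (cases "u < v") (auto simp: adj_commute)
qed

lemma delete_vertex_in:
  assumes "hereditary P" "G \<in> P"
  shows "delete_vertex G w \<in> P"
proof -
  have "induced_osub (delete_vertex G w) G"
    unfolding induced_osub_def
  proof (intro exI conjI ballI)
    show "strict_mono_on {1..fst (delete_vertex G w)} (skip w)"
      by (simp add: strict_mono_on_def)
    show "skip w ` {1..fst (delete_vertex G w)} \<subseteq> {1..fst G}"
      using skip_le skip_ge by fastforce
    fix i j assume ij: "i \<in> {1..fst (delete_vertex G w)}" "j \<in> {1..fst (delete_vertex G w)}"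
    show "{i, j} \<in> snd (delete_vertex G w) \<longleftrightarrow> {skip w i, skip w j} \<in> snd G"
    proof (cases "i = j")
      \<comment> \<open>\<open>induced_osub\<close> also compares the diagonal, where
        \<open>{i, i}\<close> is a singleton and hence an edge of neither graph.\<close>
      case True
      have "{x} \<notin> snd H" if "is_ograph H" for H x
        using that unfolding is_ograph_def by (fastforce simp: doubleton_eq_iff)
      then show ?thesis using True is_ograph_delete_vertex assms by (simp add: hereditary_def)
    next
      case False
      with ij adj_delete_vertex[of i j G w] show ?thesis
        by (simp add: adj_def)
    qed
  qed
  with assms is_ograph_delete_vertex show ?thesis unfolding hereditary_def by blast
qed

text \<open>The deleted vertex is interior to its block, so whatever it witnesses is also witnessed by
  one of its two neighbours, and no break is created or lost.\<close>

context
  fixes G :: ograph and w :: nat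
  assumes w: "2 \<le> w" "Suc w \<le> fst G"
    and bw: "block G (w - 1) = block G w" "block G (Suc w) = block G w"
begin

lemma breaks_delete_vertex:
  assumes p: "1 \<le> p" "Suc p \<le> fst G - 1"
  shows "p \<in> breaks (delete_vertex G w) \<longleftrightarrow> block G (skip w p) \<noteq> block G (skip w (Suc p))"
proof (cases "Suc p = w")
  \<comment> \<open>The new neighbours \<open>p\<close> and \<open>Suc p\<close> come from
    \<open>w - 1\<close> and \<open>Suc w\<close>, which are not consecutive in \<open>G\<close>;
    that both lie in the block of \<open>w\<close> rules out a break.\<close>
  case True
  have "adj (delete_vertex G w) z p = adj (delete_vertex G w) z (Suc p)"
    if "1 \<le> z" "z \<le> fst G - 1" "z \<noteq> p" "z \<noteq> Suc p" for z
  proof -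
    have "skip w z < p \<or> Suc (Suc p) < skip w z"
      using that True by (auto simp: skip_def)
    moreover have "block G p = block G (Suc (Suc p))" using bw True by auto
    ultimately have "adj G (skip w z) p = adj G (skip w z) (Suc (Suc p))"
      using p w True that skip_le[of z "fst G" w] skip_ge[of z w] by (intro adj_block_eq) auto
    moreover have "skip w p = p" "skip w (Suc p) = Suc (Suc p)" using True by (auto simp: skip_def)
    ultimately show ?thesis using that p by (simp add: adj_delete_vertex)
  qed
  then have "p \<notin> breaks (delete_vertex G w)"
    by (auto simp: breaks_def)
  moreover have "block G (skip w p) = block G (skip w (Suc p))"
    using True bw by (auto simp: skip_def)
  ultimately show ?thesis by simp
next
  case False
  then have sk: "skip w (Suc p) = Suc (skip w p)" by (auto simp: skip_def)
  have "p \<in> breaks (delete_vertex G w) \<longleftrightarrow> skip w p \<in> breaks G"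
  proof
    assume "p \<in> breaks (delete_vertex G w)"
    then obtain z where z: "1 \<le> z" "z \<le> fst G - 1" "z \<noteq> p" "z \<noteq> Suc p"
      "adj (delete_vertex G w) z p \<noteq> adj (delete_vertex G w) z (Suc p)"
      unfolding breaks_def by fastforce
    then have "adj G (skip w z) (skip w p) \<noteq> adj G (skip w z) (skip w (Suc p))"
      using p by (simp add: adj_delete_vertex)
    moreover have "skip w z \<in> {1..fst G} - {skip w p, Suc (skip w p)}"
      using z skip_le[of z "fst G" w] skip_ge[of z w] unfolding sk[symmetric]
      by (auto simp: skip_def split: if_splits)
    moreover have "skip w p < fst G" using p by (auto simp: skip_def)
    ultimately show "skip w p \<in> breaks G"
      using p skip_ge[of p w] sk by (auto simp: breaks_def)
  next
    assume "skip w p \<in> breaks G"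
    then obtain z where z: "1 \<le> z" "z \<le> fst G" "z \<noteq> skip w p" "z \<noteq> Suc (skip w p)"
      "adj G z (skip w p) \<noteq> adj G z (Suc (skip w p))"
      unfolding breaks_def by fastforce
    \<comment> \<open>A witness equal to \<open>w\<close> is lost. It is replaced by its neighbour
      on the side away from the pair: \<open>Suc w\<close> if the pair lies to the left of
      \<open>w\<close>, \<open>w - 1\<close> if it lies to the right. The other neighbour could
      belong to the pair.\<close>
    obtain z' where z': "1 \<le> z'" "z' \<le> fst G" "z' \<noteq> w" "z' \<noteq> skip w p" "z' \<noteq> Suc (skip w p)"
      "adj G z' (skip w p) \<noteq> adj G z' (Suc (skip w p))"
    proof (cases "z = w")
      case False
      with z that show ?thesis by blast
    next
      case zw: True
      show ?thesis
      proof (cases "p < w")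
        case True
        then have *: "Suc p < w" using False by auto
        then have "adj G x w = adj G x (Suc w)" if "x = p \<or> x = Suc p" for x
          using that w bw p by (intro adj_block_eq) auto
        then have "adj G (Suc w) x = adj G z x" if "x = p \<or> x = Suc p" for x
          using that zw adj_commute by metis
        then show ?thesis using that[of "Suc w"] z zw w * True
          by (auto simp: skip_def)
      next
        case False
        then have "adj G x (w - 1) = adj G x w" if "x = Suc p \<or> x = Suc (Suc p)" for x
          using that w bw p by (intro adj_block_eq) auto
        then have "adj G (w - 1) x = adj G z x" if "x = Suc p \<or> x = Suc (Suc p)" for x
          using that zw adj_commute by metis
        then show ?thesis using that[of "w - 1"] z zw w False
          by (auto simp: skip_def)
      qed
    qed
    then obtain y where y: "1 \<le> y" "y \<le> fst G - 1" "z' = skip w y"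
      using skip_surj[of z' "fst G" w] w by auto
    then have "y \<noteq> p" "y \<noteq> Suc p" using z' sk by auto
    moreover have "adj (delete_vertex G w) y p \<noteq> adj (delete_vertex G w) y (Suc p)"
      using y z' p calculation sk by (simp add: adj_delete_vertex)
    ultimately show "p \<in> breaks (delete_vertex G w)"
      using y p by (auto simp: breaks_def)
  qed
  also have "\<dots> \<longleftrightarrow> block G (skip w p) \<noteq> block G (skip w (Suc p))"
    by (simp add: sk block_Suc)
  finally show ?thesis .
qed

text \<open>At a break of the smaller graph the block numbers in \<open>G\<close> differ; this bound
  makes the increase exactly one, as the induction for \<open>block_delete_vertex\<close>
  needs.\<close>

lemma block_skip_Suc:
  assumes "1 \<le> p"
  shows "block G (skip w (Suc p)) \<le> Suc (block G (skip w p))"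
proof (cases "Suc p = w")
  case True
  then show ?thesis using bw by (auto simp: skip_def)
next
  case False
  then have "skip w (Suc p) = Suc (skip w p)" by (auto simp: skip_def)
  then show ?thesis by (simp add: block_Suc)
qed

lemma block_delete_vertex:
  assumes "1 \<le> u" "u \<le> fst G - 1"
  shows "block (delete_vertex G w) u = block G (skip w u)"
  using assms
proof (induction u rule: dec_induct)
  case base
  then show ?case using w by (simp add: skip_def block_1)
next
  case (step u)
  have "block G (skip w u) \<le> block G (skip w (Suc u))" by (rule block_mono) (auto simp: skip_def)
  then show ?case
    using step breaks_delete_vertex[of u] block_skip_Suc[of u] by (auto simp: block_Suc)
qed

lemma core_delete_vertex: "core (delete_vertex G w) = core G"
proof safe
  fix a b assume "(a, b) \<in> core (delete_vertex G w)"
  then obtain u v where uv: "1 \<le> u" "u < v" "v \<le> fst G - 1" "adj (delete_vertex G w) u v"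
    "a = block (delete_vertex G w) u" "b = block (delete_vertex G w) v"
    by (auto simp: core_def)
  then have "adj G (skip w u) (skip w v)" "a = block G (skip w u)" "b = block G (skip w v)"
    using adj_delete_vertex[of u v G w] by (simp_all add: block_delete_vertex)
  then show "(a, b) \<in> core G"
    using uv skip_le[of v "fst G" w] skip_ge[of u w] skip_less_iff[of w u v]
    unfolding core_def by (auto simp del: skip_less_iff)
next
  fix a b assume "(a, b) \<in> core G"
  then obtain u v where uv: "1 \<le> u" "u < v" "v \<le> fst G" "(block G u, block G v) \<in> core G"
    "a = block G u" "b = block G v"
    by (auto simp: core_def)
  \<comment> \<open>A pair using \<open>w\<close> is moved off it within the block: a left end goes
    to \<open>w - 1\<close>, a right end to \<open>Suc w\<close>, so the ends stay in order.\<close>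
  define u' where "u' = (if u = w then w - 1 else u)"
  define v' where "v' = (if v = w then Suc w else v)"
  have *: "1 \<le> u'" "u' < v'" "v' \<le> fst G" "u' \<noteq> w" "v' \<noteq> w" "a = block G u'" "b = block G v'"
    using uv w bw by (auto simp: u'_def v'_def)
  then have "adj G u' v'" using uv by (simp add: adj_iff_core)
  obtain x where x: "1 \<le> x" "x \<le> fst G - 1" "u' = skip w x"
    using skip_surj[of u' "fst G" w] * w by auto
  obtain y where y: "1 \<le> y" "y \<le> fst G - 1" "v' = skip w y"
    using skip_surj[of v' "fst G" w] * w by auto
  have "x < y" using * x y by simp
  then have "adj (delete_vertex G w) x y" using \<open>adj G u' v'\<close> x y by (simp add: adj_delete_vertex)
  moreover have "a = block (delete_vertex G w) x" "b = block (delete_vertex G w) y"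
    using * x y by (simp_all add: block_delete_vertex)
  moreover have "y \<le> fst (delete_vertex G w)" using y by simp
  ultimately show "(a, b) \<in> core (delete_vertex G w)"
    using x \<open>x < y\<close> unfolding core_def by blast
qed

lemma sizes_delete_vertex:
  assumes "card (breaks G) < b"
  shows "sizes b (delete_vertex G w) = (sizes b G)[block G w := sizes b G ! block G w - 1]"
proof (rule nth_equalityI)
  fix i assume "i < length (sizes b (delete_vertex G w))"
  then have i: "i < b" by (simp add: sizes_def)
  have "skip w ` {v \<in> {1..fst G - 1}. block (delete_vertex G w) v = i}
      = {v \<in> {1..fst G}. block G v = i} - {w}" (is "skip w ` ?A = ?B")
  proof (intro subset_antisym subsetI)
    fix v assume v: "v \<in> ?B"
    then obtain u where "1 \<le> u" "u \<le> fst G - 1" "v = skip w u"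
      using skip_surj[of v "fst G" w] w by auto
    with v show "v \<in> skip w ` ?A" by (auto simp: block_delete_vertex)
  next
    fix v assume "v \<in> skip w ` ?A"
    then obtain u where "1 \<le> u" "u \<le> fst G - 1" "v = skip w u" "block G v = i"
      by (auto simp: block_delete_vertex)
    then show "v \<in> ?B" using skip_le[of u "fst G" w] skip_ge[of u w] by auto
  qed
  moreover have "card (skip w ` ?A) = card ?A"
    by (rule card_image) (auto simp: inj_on_def skip_def split: if_splits)
  ultimately have "card ?A = card ?B" by simp
  then have L: "sizes b (delete_vertex G w) ! i = card ?B" using i by (simp add: sizes_def)
  have i': "i < length (sizes b G)" "sizes b G ! i = card {v \<in> {1..fst G}. block G v = i}"
    using i by (simp_all add: sizes_def)
  show "sizes b (delete_vertex G w) ! i = (sizes b G)[block G w := sizes b G ! block G w - 1] ! i"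
  proof (cases "block G w = i")
    case True
    then have "card ?B = card {v \<in> {1..fst G}. block G v = i} - 1"
      using w by (intro card_Diff_singleton) auto
    then show ?thesis using L i' True by simp
  next
    case False
    then have "?B = {v \<in> {1..fst G}. block G v = i}" by auto
    then show ?thesis using L i' False by simp
  qed
qed (simp add: sizes_def)

end

text \<open>A block is an interval, and three members put its maximum at least two above its
  minimum; the vertex right after the minimum is then interior.\<close>

lemma large_block_interior:
  assumes "3 \<le> card {v \<in> {1..n}. block G v = i}"
  obtains w where "2 \<le> w" "Suc w \<le> n" "block G w = i" "block G (w - 1) = i" "block G (Suc w) = i"
proof -
  let ?A = "{v \<in> {1..n}. block G v = i}"
  have A: "finite ?A" by simp
  moreover have "?A \<noteq> {}" using assms by (metis card.empty not_numeral_le_zero)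
  ultimately have M: "Min ?A \<in> ?A" "Max ?A \<in> ?A" using Min_in Max_in by blast+
  have "?A \<subseteq> {Min ?A..Max ?A}" using A by auto
  then have "card ?A \<le> card {Min ?A..Max ?A}" by (intro card_mono) auto
  then have far: "Min ?A + 2 \<le> Max ?A" using assms by simp
  have mid: "block G v = i" if "Min ?A \<le> v" "v \<le> Max ?A" for v
    using block_mono[OF that(1), of G] block_mono[OF that(2), of G] M by auto
  show ?thesis
  proof (rule that)
    show "2 \<le> Suc (Min ?A)" "Suc (Suc (Min ?A)) \<le> n" using M far by simp_all
    show "block G (Suc (Min ?A)) = i" "block G (Suc (Min ?A) - 1) = i" "block G (Suc (Suc (Min ?A))) = i"
      using far by (intro mid; linarith)+
  qed
qed

lemma bounded_breaks_eventually_poly: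
  assumes P: "hereditary P" and b: "\<And>G. G \<in> P \<Longrightarrow> card (breaks G) < b"
  shows "eventually_poly (\<lambda>n. int (card (slice P n)))"
proof -
  \<comment> \<open>All block numbers are below \<open>b\<close>, so \<open>core\<close> takes
    finitely many values and the slice splits into finitely many classes, on each of which
    \<open>sizes b\<close> is injective.\<close>
  define C where "C = Pow ({..<b} \<times> {..<b})"
  define S where "S c = sizes b ` {G \<in> P. core G = c}" for c
  have core_C: "core G \<in> C" if "G \<in> P" for G
    unfolding C_def core_def using b[OF that] block_le[of G] by (auto intro: le_less_trans)
  have og: "is_ograph G" if "G \<in> P" for G using P that by (simp add: hereditary_def)
  have "eventually_poly (\<lambda>n. int (card {s \<in> S c. sum_list s = n}))" for c
  proof (rule decrement_closed_eventually_poly)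
    fix s i assume s: "s \<in> S c" and i: "i < b" "3 \<le> s ! i"
    then obtain G where G: "G \<in> P" "core G = c" "s = sizes b G" by (auto simp: S_def)
    with i obtain w where w: "2 \<le> w" "Suc w \<le> fst G" "block G w = i"
      "block G (w - 1) = i" "block G (Suc w) = i"
      using large_block_interior[of "fst G" G i] by (auto simp: sizes_def)
    have "delete_vertex G w \<in> P" by (rule delete_vertex_in[OF P G(1)])
    moreover have "core (delete_vertex G w) = c" using core_delete_vertex[of w G] w G by simp
    moreover have "sizes b (delete_vertex G w) = s[i := s ! i - 1]"
      using sizes_delete_vertex[of w G b] w G b by simp
    ultimately show "s[i := s ! i - 1] \<in> S c" unfolding S_def by force
  qed (auto simp: S_def sizes_def)
  then have "eventually_poly (\<lambda>n. \<Sum>c\<in>C. int (card {s \<in> S c. sum_list s = n}))"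
    by (intro eventually_poly_sum) (auto simp: C_def)
  moreover have "card (slice P n) = (\<Sum>c\<in>C. card {s \<in> S c. sum_list s = n})" for n
  proof -
    have "slice P n = (\<Union>c\<in>C. {G \<in> P. core G = c \<and> fst G = n})"
      using core_C by (auto simp: slice_def)
    moreover have "finite {G \<in> P. core G = c \<and> fst G = n}" for c
      by (rule finite_subset[OF _ finite_slice[OF P, of n]]) (auto simp: slice_def)
    ultimately have "card (slice P n) = (\<Sum>c\<in>C. card {G \<in> P. core G = c \<and> fst G = n})"
      by (simp only:) (subst card_UN_disjoint, auto simp: C_def)
    also have "\<dots> = (\<Sum>c\<in>C. card {s \<in> S c. sum_list s = n})"
    proof (rule sum.cong[OF refl])
      fix c
      have "sizes b ` {G \<in> P. core G = c \<and> fst G = n} = {s \<in> S c. sum_list s = n}"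
        using sum_list_sizes b by (fastforce simp: S_def)
      moreover have "card (sizes b ` {G \<in> P. core G = c \<and> fst G = n}) = card {G \<in> P. core G = c \<and> fst G = n}"
        by (intro card_image inj_onI sizes_core_inj) (use og b in auto)
      ultimately show "card {G \<in> P. core G = c \<and> fst G = n} = card {s \<in> S c. sum_list s = n}"
        by simp
    qed
    finally show ?thesis .
  qed
  ultimately show ?thesis by simp
qed

section \<open>Graphs with many breaks\<close>

text \<open>Boolean lists encode compositions into parts 1 (False) and 2 (True), which the Fibonacci
  numbers count.\<close>

primrec weight :: "bool list \<Rightarrow> nat" where
  "weight [] = 0"
| "weight (b # c) = (if b then 2 else 1) + weight c"

lemma weight_eq_0 [simp]: "weight c = 0 \<longleftrightarrow> c = []"
  by (cases c) auto

lemma length_le_weight: "length c \<le> weight c"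
  by (induction c) auto

lemma compositions_card:
  "finite {c. weight c = n} \<and> card {c. weight c = n} = fibF n"
proof (induction n rule: fibF.induct)
  case 2
  have "weight c = Suc 0 \<longleftrightarrow> c = [False]" for c by (cases c) auto
  then show ?case by simp
next
  case (3 n)
  have *: "{c. weight c = Suc (Suc n)} = (#) False ` {c. weight c = Suc n} \<union> (#) True ` {c. weight c = n}"
    (is "?L = ?A \<union> ?B")
  proof (intro subset_antisym subsetI)
    fix c assume "c \<in> ?L"
    then show "c \<in> ?A \<union> ?B" by (cases c) (auto split: if_splits)
  qed auto
  have "card (?A \<union> ?B) = card ?A + card ?B"
    using 3 by (intro card_Un_disjoint) auto
  moreover have "card ?A = card {c. weight c = Suc n}" "card ?B = card {c. weight c = n}"
    by (simp_all add: card_image)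
  ultimately show ?case using 3 unfolding * by simp
qed simp

section \<open>Families of distinguishable induced subgraphs\<close>

text \<open>With \<open>R\<close> the order, this certifies at least \<open>fibF m\<close> induced
  subgraphs on \<open>m\<close> vertices that differ as labelled graphs. \<open>R\<close> is a
  parameter so that mirror-image configurations can be listed in decreasing order instead of
  reversing \<open>G\<close>. Codes are boolean lists because these serve both compositions and
  binary words.\<close>

definition rich :: "(nat \<Rightarrow> nat \<Rightarrow> bool) \<Rightarrow> ograph \<Rightarrow> nat \<Rightarrow> bool" where
  "rich R G m \<longleftrightarrow> (\<exists>(I :: bool list set) F. finite I \<and> fibF m \<le> card I \<and>
     (\<forall>c\<in>I. length (F c) = m \<and> sorted_wrt R (F c) \<and> set (F c) \<subseteq> {1..fst G}) \<and>
     (\<forall>c\<in>I. \<forall>c'\<in>I. c \<noteq> c' \<longrightarrow>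
        (\<exists>i<m. \<exists>j<m. i \<noteq> j \<and> adj G (F c ! i) (F c ! j) \<noteq> adj G (F c' ! i) (F c' ! j))))"

lemma richI:
  fixes F :: "bool list \<Rightarrow> nat list"
  assumes "finite I" "fibF m \<le> card I"
    and "\<And>c. c \<in> I \<Longrightarrow> length (F c) = m"
    and "\<And>c. c \<in> I \<Longrightarrow> sorted_wrt R (F c)"
    and "\<And>c. c \<in> I \<Longrightarrow> set (F c) \<subseteq> {1..fst G}"
    and "\<And>c c'. c \<in> I \<Longrightarrow> c' \<in> I \<Longrightarrow> c \<noteq> c' \<Longrightarrow>
        \<exists>i<m. \<exists>j<m. i \<noteq> j \<and> adj G (F c ! i) (F c ! j) \<noteq> adj G (F c' ! i) (F c' ! j)"
  shows "rich R G m"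
  unfolding rich_def
  by (intro exI[of _ I] exI[of _ F] conjI ballI impI) (rule assms; assumption)+

lemma richE:
  assumes "rich R G m"
  obtains I and F :: "bool list \<Rightarrow> nat list" where "finite I" "fibF m \<le> card I"
    and "\<And>c. c \<in> I \<Longrightarrow> length (F c) = m \<and> sorted_wrt R (F c) \<and> set (F c) \<subseteq> {1..fst G}"
    and "\<And>c c'. c \<in> I \<Longrightarrow> c' \<in> I \<Longrightarrow> c \<noteq> c' \<Longrightarrow>
        \<exists>i<m. \<exists>j<m. i \<noteq> j \<and> adj G (F c ! i) (F c ! j) \<noteq> adj G (F c' ! i) (F c' ! j)"
proof -
  from assms obtain I :: "bool list set" and F :: "bool list \<Rightarrow> nat list"
    where 1: "finite I" and 2: "fibF m \<le> card I"
    and 3: "\<forall>c\<in>I. length (F c) = m \<and> sorted_wrt R (F c) \<and> set (F c) \<subseteq> {1..fst G}"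
    and 4: "\<forall>c\<in>I. \<forall>c'\<in>I. c \<noteq> c' \<longrightarrow>
        (\<exists>i<m. \<exists>j<m. i \<noteq> j \<and> adj G (F c ! i) (F c ! j) \<noteq> adj G (F c' ! i) (F c' ! j))"
    unfolding rich_def by (elim exE conjE)
  show ?thesis
    by (rule that[OF 1 2 bspec[OF 3] mp[OF bspec[OF bspec[OF 4]]]])
qed

text \<open>Reversing every list moves position \<open>k\<close> to \<open>m - Suc k\<close> for all
  codes alike, so the same codes are told apart. Mirror-image cases are reduced in this way.\<close>

lemma rich_converse:
  assumes "rich (\<lambda>a b. R b a) G m"
  shows "rich R G m"
proof -
  obtain I and F :: "bool list \<Rightarrow> nat list" where I: "finite I" "fibF m \<le> card I"
    and F: "\<And>c. c \<in> I \<Longrightarrow> length (F c) = m \<and> sorted_wrt (\<lambda>a b. R b a) (F c) \<and> set (F c) \<subseteq> {1..fst G}"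
    and d: "\<And>c c'. c \<in> I \<Longrightarrow> c' \<in> I \<Longrightarrow> c \<noteq> c' \<Longrightarrow>
        \<exists>i<m. \<exists>j<m. i \<noteq> j \<and> adj G (F c ! i) (F c ! j) \<noteq> adj G (F c' ! i) (F c' ! j)"
    by (rule richE[OF assms]) (rule that)
  show ?thesis
  proof (rule richI[OF I, of "\<lambda>c. rev (F c)"])
    fix c c' assume c: "c \<in> I" "c' \<in> I" "c \<noteq> c'"
    obtain i j where ij: "i < m" "j < m" "i \<noteq> j"
      "adj G (F c ! i) (F c ! j) \<noteq> adj G (F c' ! i) (F c' ! j)"
      using d[OF c] by blast
    have r: "rev (F a) ! (m - Suc k) = F a ! k" if "a \<in> I" "k < m" for a k
      using that F[of a] by (simp add: rev_nth)
    show "\<exists>i<m. \<exists>j<m. i \<noteq> j \<and>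
        adj G (rev (F c) ! i) (rev (F c) ! j) \<noteq> adj G (rev (F c') ! i) (rev (F c') ! j)"
      by (rule exI[of _ "m - Suc i"], rule conjI, use ij in simp,
          rule exI[of _ "m - Suc j"]) (use ij c r in simp)
  qed (use F in \<open>auto simp: sorted_wrt_rev\<close>)
qed

text \<open>\<open>H c\<close> is \<open>G\<close> pulled back along the list \<open>F c\<close>,
  with positions from 0 shifted to vertices from 1. A pair of positions with different adjacency
  makes two such graphs unequal, so \<open>H\<close> is injective on the codes.\<close>

lemma rich_imp_fibF_le:
  assumes P: "hereditary P" "G \<in> P" and rich: "rich (<) G m"
  shows "fibF m \<le> card (slice P m)"
proof -
  obtain I and F :: "bool list \<Rightarrow> nat list" where I: "finite I" "fibF m \<le> card I"
    and F: "\<And>c. c \<in> I \<Longrightarrow> length (F c) = m \<and> sorted_wrt (<) (F c) \<and> set (F c) \<subseteq> {1..fst G}"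
    and d: "\<And>c c'. c \<in> I \<Longrightarrow> c' \<in> I \<Longrightarrow> c \<noteq> c' \<Longrightarrow>
        \<exists>i<m. \<exists>j<m. i \<noteq> j \<and> adj G (F c ! i) (F c ! j) \<noteq> adj G (F c' ! i) (F c' ! j)"
    by (rule richE[OF rich]) (rule that)
  define H :: "bool list \<Rightarrow> ograph" where
    "H c = (m, {{Suc i, Suc j} | i j. i < j \<and> j < m \<and> adj G (F c ! i) (F c ! j)})" for c
  have H_adj: "adj (H c) (Suc i) (Suc j) \<longleftrightarrow> adj G (F c ! i) (F c ! j)"
    if "i < m" "j < m" "i \<noteq> j" for c i j
  proof -
    have "adj (H c) (Suc i) (Suc j) \<longleftrightarrow> adj G (F c ! i) (F c ! j)" if "i < j" "j < m" for i j
      using that unfolding adj_def H_def by (auto simp: doubleton_eq_iff)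
    from this[of i j] this[of j i] that show ?thesis
      by (cases "i < j") (auto simp: adj_commute)
  qed
  have H_og: "is_ograph (H c)" for c
    unfolding is_ograph_def
  proof
    fix e assume "e \<in> snd (H c)"
    then obtain i j where "i < j" "j < m" "e = {Suc i, Suc j}" by (auto simp: H_def)
    then show "\<exists>i j. 1 \<le> i \<and> i < j \<and> j \<le> fst (H c) \<and> e = {i, j}"
      by (intro exI[of _ "Suc i"] exI[of _ "Suc j"]) (simp add: H_def)
  qed
  have sing: "{x} \<notin> snd K" if "is_ograph K" for K x
    using that unfolding is_ograph_def by (fastforce simp: doubleton_eq_iff)
  have "H c \<in> slice P m" if c: "c \<in> I" for c
  proof -
    have "induced_osub (H c) G"
      unfolding induced_osub_def
    proof (intro exI conjI ballI)
      show "strict_mono_on {1..fst (H c)} (\<lambda>i. F c ! (i - 1))"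
        using F[OF c] by (auto simp: strict_mono_on_def H_def sorted_wrt_iff_nth_less)
      have "F c ! (i - 1) \<in> {1..fst G}" if "1 \<le> i" "i \<le> m" for i
      proof -
        have "F c ! (i - 1) \<in> set (F c)" using F[OF c] that by (intro nth_mem) simp
        with F[OF c] show ?thesis by blast
      qed
      then show "(\<lambda>i. F c ! (i - 1)) ` {1..fst (H c)} \<subseteq> {1..fst G}"
        by (intro image_subsetI) (simp add: H_def)
      fix i j assume ij: "i \<in> {1..fst (H c)}" "j \<in> {1..fst (H c)}"
      show "{i, j} \<in> snd (H c) \<longleftrightarrow> {F c ! (i - 1), F c ! (j - 1)} \<in> snd G"
      proof (cases "i = j")
        case True
        then show ?thesis using sing H_og P by (simp add: hereditary_def)
      next
        case False
        have "fst (H c) = m" by (simp add: H_def)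
        with ij False have "adj (H c) i j = adj G (F c ! (i - 1)) (F c ! (j - 1))"
          using H_adj[of "i - 1" "j - 1" c] by auto
        then show ?thesis by (simp only: adj_def)
      qed
    qed
    with P H_og[of c] have "H c \<in> P" unfolding hereditary_def by blast
    then show ?thesis by (simp add: slice_def H_def)
  qed
  moreover have "inj_on H I"
  proof (rule inj_onI, rule ccontr)
    fix c c' assume c: "c \<in> I" "c' \<in> I" "H c = H c'" "c \<noteq> c'"
    with d[OF c(1,2,4)] H_adj show False by metis
  qed
  ultimately have "card I \<le> card (slice P m)"
    by (intro card_inj_on_le[OF _ _ finite_slice[OF P(1)]]) auto
  with I show ?thesis by simp
qed

section \<open>Triples that follow one another\<close>

text \<open>The index advances once per part, not once per vertex, so a common prefix of two codes
  is realised by the same vertices and a code of weight \<open>m\<close> needs at most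
  \<open>m\<close> indices.\<close>

primrec pair_word :: "(nat \<Rightarrow> nat) \<Rightarrow> (nat \<Rightarrow> nat) \<Rightarrow> nat \<Rightarrow> bool list \<Rightarrow> nat list" where
  "pair_word z w s [] = []"
| "pair_word z w s (b # c) = z s # (if b then [w s] else []) @ pair_word z w (Suc s) c"

lemma length_pair_word [simp]: "length (pair_word z w s c) = weight c"
  by (induction c arbitrary: s) auto

lemma set_pair_word: "set (pair_word z w s c) \<subseteq> (\<Union>i\<in>{s..<s + length c}. {z i, w i})"
proof (induction c arbitrary: s)
  case (Cons b c)
  have "{s..<s + length (b # c)} = insert s {Suc s..<Suc s + length c}" by auto
  then show ?case using Cons[of "Suc s"] by auto
qed simp

lemma sorted_pair_word:
  assumes "\<And>i. i < k \<Longrightarrow> R (z i) (w i)"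
    and "\<And>i j a b. i < j \<Longrightarrow> j < k \<Longrightarrow> a \<in> {z i, w i} \<Longrightarrow> b \<in> {z j, w j} \<Longrightarrow> R a b"
  shows "s + length c \<le> k \<Longrightarrow> sorted_wrt R (pair_word z w s c)"
proof (induction c arbitrary: s)
  case (Cons b c)
  have "R a x" if a: "a \<in> {z s, w s}" "x \<in> set (pair_word z w (Suc s) c)" for a x
  proof -
    obtain j where "Suc s \<le> j" "j < Suc s + length c" "x \<in> {z j, w j}"
      using subsetD[OF set_pair_word a(2)] by auto
    then show ?thesis using assms(2)[of s j a x] a(1) Cons.prems by simp
  qed
  with Cons assms(1)[of s] show ?case by auto
qed simp

text \<open>After the common prefix one list starts with \<open>z s\<close>, \<open>w s\<close>,
  whose adjacency is not \<open>g\<close>, and the other with \<open>z s\<close>,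
  \<open>z (Suc s)\<close>, whose adjacency is \<open>g\<close>. Equal weights guarantee that the
  code with the part 1 has a further part.\<close>

lemma pair_word_distinct:
  assumes "\<And>i. i < k \<Longrightarrow> adj G (z i) (w i) \<noteq> g"
    and "\<And>i j. i < j \<Longrightarrow> j < k \<Longrightarrow> adj G (z i) (z j) = g"
  shows "weight c = weight c' \<Longrightarrow> c \<noteq> c' \<Longrightarrow> s + length c \<le> k \<Longrightarrow> s + length c' \<le> k \<Longrightarrow>
    \<exists>i<weight c. \<exists>j<weight c. i \<noteq> j \<and>
      adj G (pair_word z w s c ! i) (pair_word z w s c ! j)
        \<noteq> adj G (pair_word z w s c' ! i) (pair_word z w s c' ! j)"
proof (induction c arbitrary: c' s)
  case Nil
  then show ?case by (metis weight.simps(1) weight_eq_0)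
next
  case (Cons b c)
  from Cons.prems obtain b' d where c': "c' = b' # d" by (cases c') (auto split: if_splits)
  have first: "adj G (pair_word z w s (True # e) ! 0) (pair_word z w s (True # e) ! 1)
      \<noteq> adj G (pair_word z w s (False # e') ! 0) (pair_word z w s (False # e') ! 1)"
    if "e' \<noteq> []" "s + length (False # e') \<le> k" for e e'
    using that assms(1)[of s] assms(2)[of s "Suc s"] by (cases e') auto
  have nonempty: "c \<noteq> []" if "\<not> b" "b'" using Cons.prems(1) c' that by auto
  have nonempty': "d \<noteq> []" if "b" "\<not> b'" using Cons.prems(1) c' that by auto
  show ?case
  proof (cases "b = b'")
    case False
    have "adj G (pair_word z w s (b # c) ! 0) (pair_word z w s (b # c) ! 1)
      \<noteq> adj G (pair_word z w s c' ! 0) (pair_word z w s c' ! 1)"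
      using first[of c d] first[of d c] nonempty nonempty' False Cons.prems c' by (cases b) auto
    moreover have "1 < weight (b # c)" using False nonempty by (cases b; cases c) auto
    ultimately show ?thesis by (intro exI[of _ 0] exI[of _ 1] conjI) auto
  next
    case True
    then have "\<exists>i<weight c. \<exists>j<weight c. i \<noteq> j \<and>
      adj G (pair_word z w (Suc s) c ! i) (pair_word z w (Suc s) c ! j)
        \<noteq> adj G (pair_word z w (Suc s) d ! i) (pair_word z w (Suc s) d ! j)"
      using Cons.prems c' by (intro Cons.IH) auto
    then obtain i j where ij: "i < weight c" "j < weight c" "i \<noteq> j"
      "adj G (pair_word z w (Suc s) c ! i) (pair_word z w (Suc s) c ! j)
        \<noteq> adj G (pair_word z w (Suc s) d ! i) (pair_word z w (Suc s) d ! j)" by blast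
    let ?o = "if b then 2 else 1 :: nat"
    have "pair_word z w s (b # e) ! (?o + i) = pair_word z w (Suc s) e ! i" for e i by simp
    with ij True c' show ?thesis
      by (intro exI[of _ "?o + i"] conjI exI[of _ "?o + j"]) (auto simp del: pair_word.simps)
  qed
qed

text \<open>Since \<open>z i\<close> separates \<open>x i\<close> from \<open>y i\<close>, one of
  the two disagrees with the common value \<open>g\<close> at \<open>z i\<close>; it serves as the
  partner \<open>w i\<close>.\<close>

lemma rich_local:
  assumes sep: "\<And>i. i < m \<Longrightarrow> adj G (z i) (x i) \<noteq> adj G (z i) (y i)"
    and V: "\<And>i. i < m \<Longrightarrow> {z i, x i, y i} \<subseteq> {1..fst G}"
    and R1: "\<And>i. i < m \<Longrightarrow> R (z i) (x i) \<and> R (z i) (y i)"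
    and R2: "\<And>i j a b. i < j \<Longrightarrow> j < m \<Longrightarrow> a \<in> {z i, x i, y i} \<Longrightarrow> b \<in> {z j, x j, y j} \<Longrightarrow> R a b"
    and g: "\<And>i j. i < j \<Longrightarrow> j < m \<Longrightarrow> adj G (z i) (z j) = g"
  shows "rich R G m"
proof -
  define w where "w i = (if adj G (z i) (x i) \<noteq> g then x i else y i)" for i
  have w: "w i \<in> {x i, y i}" for i by (simp add: w_def)
  have wg: "adj G (z i) (w i) \<noteq> g" if "i < m" for i using sep[OF that] by (auto simp: w_def)
  have fin: "finite {c. weight c = m}" "fibF m \<le> card {c. weight c = m}"
    using compositions_card by simp_all
  show ?thesis
  proof (rule richI[OF fin, of "pair_word z w 0"])
    fix c assume c: "c \<in> {c. weight c = m}"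
    then have len: "length c \<le> m" using length_le_weight[of c] by simp
    show "sorted_wrt R (pair_word z w 0 c)"
      by (rule sorted_pair_word[of m]) (use R1 R2 w len in \<open>auto simp: w_def\<close>)
    have "set (pair_word z w 0 c) \<subseteq> (\<Union>i<m. {z i, w i})"
      using set_pair_word[of z w 0 c] len by force
    also have "\<dots> \<subseteq> {1..fst G}" using V w by fast
    finally show "set (pair_word z w 0 c) \<subseteq> {1..fst G}" .
    fix c' assume c': "c' \<in> {c. weight c = m}" "c \<noteq> c'"
    then have len': "length c' \<le> m" using length_le_weight[of c'] by simp
    show "\<exists>i<m. \<exists>j<m. i \<noteq> j \<and> adj G (pair_word z w 0 c ! i) (pair_word z w 0 c ! j)
        \<noteq> adj G (pair_word z w 0 c' ! i) (pair_word z w 0 c' ! j)"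
      using pair_word_distinct[of m G z w g c c' 0] wg g c c' len len' by auto
  qed auto
qed

section \<open>Rows on one side of all columns\<close>

text \<open>The bipartite analogue of \<open>pair_word\<close>: a part 1 contributes alternately a row or a column
  (flag \<open>e\<close>: a row is next), so the numbers of rows and columns depend only on the weight. The
  column \<open>v e True s\<close> of a part 2 can be chosen to differ from the default entry that a part 1 would
  produce at the same place.\<close>

primrec rows :: "(nat \<Rightarrow> nat) \<Rightarrow> bool \<Rightarrow> nat \<Rightarrow> bool list \<Rightarrow> nat list" where
  "rows z e s [] = []"
| "rows z e s (b # c) = (if b \<or> e then [z s] else []) @ rows z (b = e) (Suc s) c"

primrec cols :: "(bool \<Rightarrow> bool \<Rightarrow> nat \<Rightarrow> nat) \<Rightarrow> bool \<Rightarrow> nat \<Rightarrow> bool list \<Rightarrow> nat list" where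
  "cols v e s [] = []"
| "cols v e s (b # c) = (if b \<or> \<not> e then [v e b s] else []) @ cols v (b = e) (Suc s) c"

lemma length_rows: "length (rows z e s c) = (weight c + of_bool e) div 2"
  by (induction c arbitrary: e s) (auto simp: of_bool_def)

lemma length_cols: "length (cols v e s c) = (weight c + of_bool (\<not> e)) div 2"
  by (induction c arbitrary: e s) (auto simp: of_bool_def)

lemma set_rows: "set (rows z e s c) \<subseteq> z ` {s..<s + length c}"
proof (induction c arbitrary: e s)
  case (Cons b c)
  have "{s..<s + length (b # c)} = insert s {Suc s..<Suc s + length c}" by auto
  then show ?case using Cons[of "b = e" "Suc s"] by auto
qed simp

lemma set_cols: "set (cols v e s c) \<subseteq> (\<Union>i\<in>{s..<s + length c}. {v e b i | e b. True})"
proof (induction c arbitrary: e s)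
  case (Cons b c)
  have "{s..<s + length (b # c)} = insert s {Suc s..<Suc s + length c}" by auto
  then show ?case using Cons[of "b = e" "Suc s"] by auto
qed simp

lemma sorted_rows:
  assumes "\<And>i j. i < j \<Longrightarrow> j < k \<Longrightarrow> R (z i) (z j)"
  shows "s + length c \<le> k \<Longrightarrow> sorted_wrt R (rows z e s c)"
proof (induction c arbitrary: e s)
  case (Cons b c)
  have "R (z s) x" if x: "x \<in> set (rows z (b = e) (Suc s) c)" for x
  proof -
    obtain j where "Suc s \<le> j" "j < Suc s + length c" "x = z j"
      using subsetD[OF set_rows x] by auto
    then show ?thesis using assms[of s j] Cons.prems by simp
  qed
  with Cons show ?case by auto
qed simp

lemma sorted_cols:
  assumes "\<And>i j e b e' b'. i < j \<Longrightarrow> j < k \<Longrightarrow> R (v e b i) (v e' b' j)"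
  shows "s + length c \<le> k \<Longrightarrow> sorted_wrt R (cols v e s c)"
proof (induction c arbitrary: e s)
  case (Cons b c)
  have "R (v e b s) x" if x: "x \<in> set (cols v (b = e) (Suc s) c)" for x
  proof -
    obtain j e' b' where "Suc s \<le> j" "j < Suc s + length c" "x = v e' b' j"
      using subsetD[OF set_cols x] by fastforce
    then show ?thesis using assms[of s j] Cons.prems by simp
  qed
  with Cons show ?case by auto
qed simp

text \<open>At the first difference a part 2 puts a row and a column of the same index in front,
  while a part 1 puts only one of them there. After a row the next column has a larger index and the
  entry is \<open>al\<close>; after a column the next row has a larger index and the entry is
  \<open>be\<close>. The entries in \<open>A\<close> and \<open>B\<close> avoid exactly these
  values.\<close>

lemma rows_cols_distinct:
  assumes A: "\<And>i. i < k \<Longrightarrow> adj G (z i) (v True True i) \<noteq> al"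
    and B: "\<And>i. i < k \<Longrightarrow> adj G (z i) (v False True i) \<noteq> be"
    and C: "\<And>i j e b. i < j \<Longrightarrow> j < k \<Longrightarrow> adj G (z i) (v e b j) = al"
    and D: "\<And>i j. i < j \<Longrightarrow> j < k \<Longrightarrow> adj G (z j) (v False False i) = be"
  shows "weight c = weight c' \<Longrightarrow> c \<noteq> c' \<Longrightarrow> s + length c \<le> k \<Longrightarrow> s + length c' \<le> k \<Longrightarrow>
    \<exists>i<length (rows z e s c). \<exists>j<length (cols v e s c).
      adj G (rows z e s c ! i) (cols v e s c ! j) \<noteq> adj G (rows z e s c' ! i) (cols v e s c' ! j)"
proof (induction c arbitrary: c' s e)
  case Nil
  then show ?case by (metis weight.simps(1) weight_eq_0)
next
  case (Cons b c)
  from Cons.prems obtain b' d where c': "c' = b' # d" by (cases c') (auto split: if_splits)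
  have first: "adj G (rows z e s (True # f) ! 0) (cols v e s (True # f) ! 0)
      \<noteq> adj G (rows z e s (False # f') ! 0) (cols v e s (False # f') ! 0)"
    if f': "f' \<noteq> []" "s + length (False # f') \<le> k" for f f'
  proof (cases e)
    case True
    have "cols v False (Suc s) f' \<noteq> []"
      using f'(1) length_cols[of v False "Suc s" f'] by (cases f') (auto split: if_splits)
    then have "cols v False (Suc s) f' ! 0 \<in> set (cols v False (Suc s) f')" by simp
    then obtain e' b' j where "Suc s \<le> j" "j < Suc s + length f'" "cols v False (Suc s) f' ! 0 = v e' b' j"
      using set_cols[of v False "Suc s" f'] by fastforce
    then show ?thesis using True A[of s] C[of s j e' b'] f' by auto
  next
    case False
    have "rows z True (Suc s) f' \<noteq> []"
      using f'(1) length_rows[of z True "Suc s" f'] by (cases f') (auto split: if_splits)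
    then have "rows z True (Suc s) f' ! 0 \<in> set (rows z True (Suc s) f')" by simp
    then obtain j where "Suc s \<le> j" "j < Suc s + length f'" "rows z True (Suc s) f' ! 0 = z j"
      using set_rows[of z True "Suc s" f'] by fastforce
    then show ?thesis using False B[of s] D[of s j] f' by auto
  qed
  have nonempty: "c \<noteq> []" if "\<not> b" "b'" using Cons.prems(1) c' that by auto
  have nonempty': "d \<noteq> []" if "b" "\<not> b'" using Cons.prems(1) c' that by auto
  show ?case
  proof (cases "b = b'")
    case False
    have "adj G (rows z e s (b # c) ! 0) (cols v e s (b # c) ! 0)
      \<noteq> adj G (rows z e s c' ! 0) (cols v e s c' ! 0)"
      using first[of c d] first[of d c] nonempty nonempty' False Cons.prems c'
      by (cases b) (auto simp del: rows.simps cols.simps)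
    moreover have "2 \<le> weight (b # c)" using False nonempty by (cases b; cases c) auto
    then have "0 < length (rows z e s (b # c))" "0 < length (cols v e s (b # c))"
      unfolding length_rows length_cols by linarith+
    ultimately show ?thesis by blast
  next
    case True
    then have "\<exists>i<length (rows z (b = e) (Suc s) c). \<exists>j<length (cols v (b = e) (Suc s) c).
      adj G (rows z (b = e) (Suc s) c ! i) (cols v (b = e) (Suc s) c ! j)
        \<noteq> adj G (rows z (b = e) (Suc s) d ! i) (cols v (b = e) (Suc s) d ! j)"
      using Cons.prems c' by (intro Cons.IH) auto
    then obtain i j where ij: "i < length (rows z (b = e) (Suc s) c)"
      "j < length (cols v (b = e) (Suc s) c)"
      "adj G (rows z (b = e) (Suc s) c ! i) (cols v (b = e) (Suc s) c ! j)
        \<noteq> adj G (rows z (b = e) (Suc s) d ! i) (cols v (b = e) (Suc s) d ! j)" by blast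
    \<comment> \<open>\<open>?o\<close> and \<open>?p\<close> count the rows and the columns
      contributed by the common first part.\<close>
    let ?o = "if b \<or> e then 1 else 0 :: nat"
    let ?p = "if b \<or> \<not> e then 1 else 0 :: nat"
    have shift: "rows z e s (b # f) ! (?o + i) = rows z (b = e) (Suc s) f ! i"
      "cols v e s (b # f) ! (?p + j) = cols v (b = e) (Suc s) f ! j" for f i j by auto
    have "?o + i < length (rows z e s (b # c))" "?p + j < length (cols v e s (b # c))"
      using ij by auto
    moreover have "adj G (rows z e s (b # c) ! (?o + i)) (cols v e s (b # c) ! (?p + j))
        \<noteq> adj G (rows z e s c' ! (?o + i)) (cols v e s c' ! (?p + j))"
      using ij(3) by (simp only: shift c' True[symmetric] not_False_eq_True)
    ultimately show ?thesis by blast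
  qed
qed

text \<open>Rows and columns may independently run with or against \<open>R\<close> as their index
  grows. \<open>orient\<close> puts either list into the order of \<open>R\<close>, and
  \<open>flip\<close> translates positions accordingly.\<close>

definition orient :: "bool \<Rightarrow> 'a list \<Rightarrow> 'a list" where
  "orient d l = (if d then l else rev l)"

lemma length_orient [simp]: "length (orient d l) = length l"
  and set_orient [simp]: "set (orient d l) = set l"
  by (simp_all add: orient_def)

definition flip :: "bool \<Rightarrow> nat \<Rightarrow> nat \<Rightarrow> nat" where
  "flip d n i = (if d then i else n - Suc i)"

lemma flip_less: "i < n \<Longrightarrow> flip d n i < n"
  by (simp add: flip_def)

lemma nth_orient: "i < length l \<Longrightarrow> orient d l ! flip d (length l) i = l ! i"
  by (simp add: orient_def flip_def rev_nth)

lemma sorted_orient: "sorted_wrt (\<lambda>a b. if d then R a b else R b a) l \<Longrightarrow> sorted_wrt R (orient d l)"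
  by (cases d) (simp_all add: orient_def sorted_wrt_rev)

text \<open>All rows precede all columns in \<open>R\<close>, so each list consists of its rows
  followed by its columns. Codes are told apart by row-column adjacencies alone; those among rows or
  among columns stay arbitrary.\<close>

lemma rich_matrix:
  assumes sep: "\<And>i. i < m \<Longrightarrow> adj G (z i) (x i) \<noteq> adj G (z i) (y i)"
    and V: "\<And>i. i < m \<Longrightarrow> {z i, x i, y i} \<subseteq> {1..fst G}"
    and R1: "\<And>i j. i < m \<Longrightarrow> j < m \<Longrightarrow> R (z i) (x j) \<and> R (z i) (y j)"
    and Rz: "\<And>i j. i < j \<Longrightarrow> j < m \<Longrightarrow> (if d then R (z i) (z j) else R (z j) (z i))"
    and Rx: "\<And>i j a b. i < j \<Longrightarrow> j < m \<Longrightarrow> a \<in> {x i, y i} \<Longrightarrow> b \<in> {x j, y j} \<Longrightarrow>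
        (if d' then R a b else R b a)"
    and al: "\<And>i j. i < j \<Longrightarrow> j < m \<Longrightarrow> adj G (z i) (x j) = al \<and> adj G (z i) (y j) = al"
    and be: "\<And>i j. i < j \<Longrightarrow> j < m \<Longrightarrow> adj G (z j) (x i) = be"
  shows "rich R G m"
proof -
  \<comment> \<open>A part 2 takes whichever of \<open>x i\<close>, \<open>y i\<close> disagrees
    with the default at \<open>z i\<close>; the default is \<open>al\<close> when a row is due and
    \<open>be\<close> when a column is due. A part 1 always takes \<open>x i\<close>, because
    \<open>be\<close> is assumed for \<open>x\<close> only.\<close>
  define v where "v e b i =
    (if b then (if adj G (z i) (x i) \<noteq> (if e then al else be) then x i else y i) else x i)" for e b i
  have v: "v e b i \<in> {x i, y i}" for e b i by (simp add: v_def)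
  have fin: "finite {c. weight c = m}" "fibF m \<le> card {c. weight c = m}"
    using compositions_card by simp_all
  define F where "F c = orient d (rows z True 0 c) @ orient d' (cols v True 0 c)" for c
  have len: "length c \<le> m" if "weight c = m" for c using length_le_weight[of c] that by simp
  have rows: "\<exists>i<m. a = z i" if "a \<in> set (rows z True 0 c)" "weight c = m" for a c
    using set_rows[of z True 0 c] that len[of c] by force
  have cols: "\<exists>i<m. a \<in> {x i, y i}" if a: "a \<in> set (cols v True 0 c)" "weight c = m" for a c
  proof -
    obtain i e b where "i < length c" "a = v e b i" using subsetD[OF set_cols a(1)] by fastforce
    then show ?thesis using v[of e b i] len[OF a(2)] by (intro exI[of _ i]) auto
  qed
  show ?thesis
  proof (rule richI[OF fin, of F])
    fix c assume "c \<in> {c. weight c = m}"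
    then have c: "weight c = m" by simp
    show "length (F c) = m" using c by (simp add: F_def length_rows length_cols)
    have "sorted_wrt R (orient d (rows z True 0 c))"
      by (intro sorted_orient sorted_rows[of m]) (use Rz len[OF c] in auto)
    moreover have "sorted_wrt R (orient d' (cols v True 0 c))"
      by (intro sorted_orient sorted_cols[of m] Rx) (use v len[OF c] in auto)
    moreover have "R a b" if "a \<in> set (rows z True 0 c)" "b \<in> set (cols v True 0 c)" for a b
      using rows[OF that(1) c] cols[OF that(2) c] R1 by auto
    ultimately show "sorted_wrt R (F c)" by (simp add: F_def sorted_wrt_append)
    have "a \<in> {1..fst G}" if "a \<in> set (F c)" for a
      using that rows[of a c] cols[of a c] V c unfolding F_def by fastforce
    then show "set (F c) \<subseteq> {1..fst G}" by blast
    fix c' assume "c' \<in> {c. weight c = m}" and ne: "c \<noteq> c'"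
    then have c': "weight c' = m" by simp
    have "\<exists>i<length (rows z True 0 c). \<exists>j<length (cols v True 0 c).
      adj G (rows z True 0 c ! i) (cols v True 0 c ! j) \<noteq> adj G (rows z True 0 c' ! i) (cols v True 0 c' ! j)"
    proof (rule rows_cols_distinct[of m G z v al be])
      show "adj G (z i) (v True True i) \<noteq> al" if "i < m" for i
        using sep[OF that] by (auto simp: v_def)
      show "adj G (z i) (v False True i) \<noteq> be" if "i < m" for i
        using sep[OF that] by (auto simp: v_def)
      show "adj G (z i) (v e b j) = al" if "i < j" "j < m" for i j e b
        using v[of e b j] al[OF that] by auto
      show "adj G (z j) (v False False i) = be" if "i < j" "j < m" for i j
        using be[OF that] by (simp add: v_def)
    qed (use c c' ne len in auto)
    then obtain i j where i: "i < length (rows z True 0 c)" and j: "j < length (cols v True 0 c)"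
      and ne': "adj G (rows z True 0 c ! i) (cols v True 0 c ! j)
        \<noteq> adj G (rows z True 0 c' ! i) (cols v True 0 c' ! j)" by blast
    define p where "p = length (rows z True 0 c)"
    define q where "q = length (cols v True 0 c)"
    \<comment> \<open>Equal weights give equal numbers of rows and columns, so corresponding entries
      of the two lists occupy the same positions.\<close>
    have pq: "p = length (rows z True 0 c')" "q = length (cols v True 0 c')" "p + q = m"
      using c c' by (simp_all add: p_def q_def length_rows length_cols)
    define i' where "i' = flip d p i"
    define j' where "j' = p + flip d' q j"
    have "F a ! i' = rows z True 0 a ! i" "F a ! j' = cols v True 0 a ! j" if "a = c \<or> a = c'" for a
    proof -
      have a: "length (rows z True 0 a) = p" "length (cols v True 0 a) = q"
        using that pq p_def q_def by auto
      have "i' < p" using i by (simp add: i'_def p_def flip_less)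
      then show "F a ! i' = rows z True 0 a ! i"
        using nth_orient[of i "rows z True 0 a" d] i a by (simp add: F_def nth_append i'_def p_def)
      show "F a ! j' = cols v True 0 a ! j"
        using nth_orient[of j "cols v True 0 a" d'] j a by (simp add: F_def nth_append j'_def q_def)
    qed
    moreover have "i' < m" "j' < m" "i' \<noteq> j'"
      using flip_less[of i p d] flip_less[of j q d'] i j pq(3)
      unfolding i'_def j'_def p_def[symmetric] q_def[symmetric] by auto
    ultimately show "\<exists>i<m. \<exists>j<m. i \<noteq> j \<and> adj G (F c ! i) (F c ! j) \<noteq> adj G (F c' ! i) (F c' ! j)"
      using ne' by metis
  qed
qed

section \<open>One vertex separating many pairs\<close>

lemma fibF_le_power: "fibF (Suc n) \<le> 2 ^ n"
proof -
  have "fibF (Suc n) \<le> 2 ^ n \<and> fibF (Suc (Suc n)) \<le> 2 ^ Suc n"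
  proof (induction n)
    case (Suc n)
    then show ?case by simp
  qed simp
  then show ?thesis ..
qed

text \<open>The adjacency of \<open>v\<close> to the vertex chosen from the \<open>i\<close>-th pair
  reads off the bit \<open>c ! i\<close>. For \<open>m > 0\<close> this tells apart all
  \<open>2 ^ (m - 1)\<close> words, which are at least \<open>fibF m\<close> many.\<close>

lemma rich_star:
  assumes sep: "\<And>i. i < m \<Longrightarrow> adj G v (x i) \<noteq> adj G v (y i)"
    and V: "v \<in> {1..fst G}" "\<And>i. i < m \<Longrightarrow> {x i, y i} \<subseteq> {1..fst G}"
    and R1: "\<And>i. i < m \<Longrightarrow> R v (x i) \<and> R v (y i)"
    and Rx: "\<And>i j a b. i < j \<Longrightarrow> j < m \<Longrightarrow> a \<in> {x i, y i} \<Longrightarrow> b \<in> {x j, y j} \<Longrightarrow>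
        (if d then R a b else R b a)"
  shows "rich R G m"
proof (cases m)
  case 0
  \<comment> \<open>There is no room for \<open>v\<close> when \<open>m = 0\<close>; one code with
    the empty list meets \<open>fibF 0 = 1\<close>.\<close>
  show ?thesis
    by (rule richI[of "{[]}" _ "\<lambda>_. []"]) (use 0 in auto)
next
  case (Suc n)
  define w where "w (c :: bool list) i = (if c ! i then x i else y i)" for c i
  define F where "F c = v # orient d (map (w c) [0..<n])" for c
  have w: "w c i \<in> {x i, y i}" for c i by (simp add: w_def)
  have I: "finite {c :: bool list. length c = n}" "card {c :: bool list. length c = n} = 2 ^ n"
    using finite_lists_length_eq[of "UNIV :: bool set" n] card_lists_length_eq[of "UNIV :: bool set" n]
    by simp_all
  then have I': "fibF m \<le> card {c :: bool list. length c = n}" using fibF_le_power[of n] Suc by simp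
  show ?thesis
  proof (rule richI[OF I(1) I', of F])
    fix c :: "bool list" assume c: "c \<in> {c. length c = n}"
    show "length (F c) = m" using Suc by (simp add: F_def)
    have "sorted_wrt R (orient d (map (w c) [0..<n]))"
    proof (rule sorted_orient)
      show "sorted_wrt (\<lambda>a b. if d then R a b else R b a) (map (w c) [0..<n])"
        unfolding sorted_wrt_iff_nth_less
      proof (intro allI impI)
        fix i j assume "i < j" "j < length (map (w c) [0..<n])"
        then show "if d then R (map (w c) [0..<n] ! i) (map (w c) [0..<n] ! j)
            else R (map (w c) [0..<n] ! j) (map (w c) [0..<n] ! i)"
          using Rx[of i j "w c i" "w c j"] w Suc by simp
      qed
    qed
    moreover have "R v a" if "a \<in> set (map (w c) [0..<n])" for a
      using that R1 Suc by (auto simp: w_def)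
    ultimately show "sorted_wrt R (F c)" by (simp add: F_def)
    have "w c i \<in> {1..fst G}" if "i < n" for i using V(2)[of i] w[of c i] Suc that by auto
    then show "set (F c) \<subseteq> {1..fst G}" using V(1) by (auto simp: F_def)
    fix c' :: "bool list" assume c': "c' \<in> {c. length c = n}" "c \<noteq> c'"
    with c obtain i where i: "i < n" "c ! i \<noteq> c' ! i" by (auto simp: list_eq_iff_nth_eq)
    define j where "j = Suc (flip d n i)"
    have "F a ! j = w a i" for a
      using nth_orient[of i "map (w a) [0..<n]" d] i by (simp add: F_def j_def)
    moreover have "adj G v (w c i) \<noteq> adj G v (w c' i)" using i sep[of i] Suc by (auto simp: w_def)
    moreover have "F a ! 0 = v" for a by (simp add: F_def)
    moreover have "0 < m" "j < m" "0 \<noteq> j" using flip_less[OF i(1), of d] Suc by (auto simp: j_def)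
    ultimately show "\<exists>i<m. \<exists>j<m. i \<noteq> j \<and> adj G (F c ! i) (F c ! j) \<noteq> adj G (F c' ! i) (F c' ! j)"
      by metis
  qed
qed

section \<open>Homogeneous systems of triples\<close>

text \<open>The partition relation concerns numbered colours of 2-element sets. Colours are numbered
  by \<open>e\<close>, and a set is coloured through its minimum and maximum, so \<open>col\<close>
  need not be symmetric.\<close>

lemma ramsey_finite_colours:
  fixes k :: nat
  shows "\<exists>N :: nat. \<forall>col :: nat \<Rightarrow> nat \<Rightarrow> 'c :: finite. \<exists>h a. strict_mono_on {..<k} h \<and> h ` {..<k} \<subseteq> {..<N} \<and>
     (\<forall>i j. i < j \<longrightarrow> j < k \<longrightarrow> col (h i) (h j) = a)"
proof -
  obtain e :: "'c \<Rightarrow> nat" where e: "bij_betw e UNIV {0..<card (UNIV :: 'c set)}"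
    using ex_bij_betw_finite_nat[of "UNIV :: 'c set"] by auto
  obtain N :: nat where N: "partn_lst {..<N} (replicate (card (UNIV :: 'c set)) k) (2 :: nat)"
    using ramsey_full by blast
  have "\<exists>h a. strict_mono_on {..<k} h \<and> h ` {..<k} \<subseteq> {..<N} \<and>
     (\<forall>i j. i < j \<longrightarrow> j < k \<longrightarrow> col (h i) (h j) = a)" for col :: "nat \<Rightarrow> nat \<Rightarrow> 'c"
  proof -
    define f where "f S = e (col (Min S) (Max S))" for S
    have "f \<in> nsets {..<N} 2 \<rightarrow> {..<card (UNIV :: 'c set)}"
      using e by (auto simp: f_def bij_betw_def)
    then obtain c H where c: "c < card (UNIV :: 'c set)" and H: "H \<in> nsets {..<N} k" "f ` nsets H 2 \<subseteq> {c}"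
      by (rule partn_lstE[OF N]) auto
    have fin: "finite H" "card H = k" "H \<subseteq> {..<N}" using H(1) by (auto simp: nsets_def)
    define h where "h i = sorted_list_of_set H ! i" for i
    have len: "length (sorted_list_of_set H) = k" using fin by simp
    have hH: "h i \<in> H" if "i < k" for i
      using that len fin nth_mem[of i "sorted_list_of_set H"] by (simp add: h_def)
    have mono: "h i < h j" if "i < j" "j < k" for i j
      using that len strict_sorted_list_of_set[of H] unfolding h_def
      by (simp add: sorted_wrt_iff_nth_less)
    have "e (col (h i) (h j)) = c" if "i < j" "j < k" for i j
    proof -
      have "{h i, h j} \<in> nsets H 2" using hH mono[OF that] that by auto
      then have "f {h i, h j} = c" using subsetD[OF H(2) imageI] by simp
      moreover have "Min {h i, h j} = h i" "Max {h i, h j} = h j" using mono[OF that] by auto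
      ultimately show ?thesis by (simp add: f_def)
    qed
    then have "col (h i) (h j) = inv e c" if "i < j" "j < k" for i j
      using that e by (metis bij_betw_def inv_f_f)
    moreover have "strict_mono_on {..<k} h" using mono by (auto simp: strict_mono_on_def)
    ultimately show ?thesis using hH fin(3) by blast
  qed
  then show ?thesis by blast
qed

text \<open>The cases, up to reversal of the order: all \<open>Z i\<close> coincide or see alternating columns (star),
  the triples are consecutive (local), or all \<open>Z i\<close> lie on one side of all \<open>X j\<close> (matrix). Three
  spare indices exclude \<open>Z i\<close> from lying in another pair. A single tuple-valued colour is used
  so that Ramsey's theorem applies once.\<close>

lemma rich_homogeneous_triples:
  fixes X Z :: "nat \<Rightarrow> nat"
  assumes Xb: "\<And>i. i < m + 3 \<Longrightarrow> 1 \<le> X i \<and> Suc (X i) \<le> fst G"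
    and X: "\<And>i j. i < j \<Longrightarrow> j < m + 3 \<Longrightarrow> Suc (X i) < X j"
    and Z: "\<And>i. i < m + 3 \<Longrightarrow> 1 \<le> Z i \<and> Z i \<le> fst G \<and> Z i \<noteq> X i \<and> Z i \<noteq> Suc (X i)"
    and sep: "\<And>i. i < m + 3 \<Longrightarrow> adj G (Z i) (X i) \<noteq> adj G (Z i) (Suc (X i))"
    and col: "\<And>i j. i < j \<Longrightarrow> j < m + 3 \<Longrightarrow>
      (Z i < X i, Z j < X i, Suc (X i) < Z j, Z i < X j, Suc (X j) < Z i, Z i < Z j, Z i = Z j,
       adj G (Z i) (Z j), adj G (Z i) (X j), adj G (Z i) (Suc (X j)), adj G (Z j) (X i))
      = (b1, b2, b3, b4, b5, b6, b7, a1, a2, a3, a4)"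
  shows "rich (<) G m"
proof -
  have c: "Z i < X i \<longleftrightarrow> b1" "Z j < X i \<longleftrightarrow> b2" "Suc (X i) < Z j \<longleftrightarrow> b3" "Z i < X j \<longleftrightarrow> b4"
    "Suc (X j) < Z i \<longleftrightarrow> b5" "Z i < Z j \<longleftrightarrow> b6" "Z i = Z j \<longleftrightarrow> b7"
    "adj G (Z i) (Z j) \<longleftrightarrow> a1" "adj G (Z i) (X j) \<longleftrightarrow> a2" "adj G (Z i) (Suc (X j)) \<longleftrightarrow> a3"
    "adj G (Z j) (X i) \<longleftrightarrow> a4" if "i < j" "j < m + 3" for i j
    using col[OF that] by simp_all
  have X': "a < b" if "i < j" "j < m + 3" "a \<in> {X i, Suc (X i)}" "b \<in> {X j, Suc (X j)}" for i j a b
    using X[OF that(1,2)] that(3,4) by auto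
  have V: "{Z i, X i, Suc (X i)} \<subseteq> {1..fst G}" if "i < m + 3" for i
    using Xb[OF that] Z[OF that] by auto
  \<comment> \<open>Homogeneity relates only different indices, so \<open>Z 0\<close> is used with
    the pairs of index 1 and above.\<close>
  have star_left: "rich (<) G m"
    if s: "\<And>i. i < m \<Longrightarrow> adj G (Z 0) (X (Suc i)) \<noteq> adj G (Z 0) (Suc (X (Suc i)))"
      and l: "\<And>i. i < m \<Longrightarrow> Z 0 < X (Suc i)"
  proof (rule rich_star[OF s, where d = True])
    show "Z 0 \<in> {1..fst G}" using V[of 0] by simp
    show "{X (Suc i), Suc (X (Suc i))} \<subseteq> {1..fst G}" if "i < m" for i using V[of "Suc i"] that by simp
    show "Z 0 < X (Suc i) \<and> Z 0 < Suc (X (Suc i))" if "i < m" for i using l[OF that] by simp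
    show "if True then a < b else b < a" if "i < j" "j < m"
      "a \<in> {X (Suc i), Suc (X (Suc i))}" "b \<in> {X (Suc j), Suc (X (Suc j))}" for i j a b
      using X'[of "Suc i" "Suc j" a b] that by simp
  qed
  have star_right: "rich (<) G m"
    if s: "\<And>i. i < m \<Longrightarrow> adj G (Z 0) (X (Suc i)) \<noteq> adj G (Z 0) (Suc (X (Suc i)))"
      and l: "\<And>i. i < m \<Longrightarrow> Suc (X (Suc i)) < Z 0"
  proof (rule rich_converse, rule rich_star[OF s, where d = False])
    show "Z 0 \<in> {1..fst G}" using V[of 0] by simp
    show "{X (Suc i), Suc (X (Suc i))} \<subseteq> {1..fst G}" if "i < m" for i using V[of "Suc i"] that by simp
    show "X (Suc i) < Z 0 \<and> Suc (X (Suc i)) < Z 0" if "i < m" for i using l[OF that] by simp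
    show "if False then b < a else a < b" if "i < j" "j < m"
      "a \<in> {X (Suc i), Suc (X (Suc i))}" "b \<in> {X (Suc j), Suc (X (Suc j))}" for i j a b
      using X'[of "Suc i" "Suc j" a b] that by simp
  qed
  show ?thesis
  proof (cases b7)
    case True
    then have Z0: "Z (Suc i) = Z 0" if "i < m" for i using c(7)[of 0 "Suc i"] that by simp
    have s: "adj G (Z 0) (X (Suc i)) \<noteq> adj G (Z 0) (Suc (X (Suc i)))" if "i < m" for i
      using sep[of "Suc i"] Z0[OF that] that by simp
    show ?thesis
    proof (cases b4)
      case True
      then show ?thesis by (intro star_left s) (use c(4)[of 0] in auto)
    next
      case False
      have "Suc (X (Suc i)) < Z 0" if "i < m" for i
        using c(4)[of 0 "Suc i"] Z[of "Suc i"] Z0[OF that] False that by auto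
      then show ?thesis by (intro star_right s)
    qed
  next
    case n7: False
    then have b6: "if b6 then Z i < Z j else Z j < Z i" if "i < j" "j < m" for i j
      using c(6,7)[of i j] that by auto
    \<comment> \<open>If \<open>a2\<close> and \<open>a3\<close> differ, \<open>Z 0\<close> itself
      separates every later pair, so a star arises although the \<open>Z i\<close> are
      distinct.\<close>
    have s: "adj G (Z 0) (X (Suc i)) \<noteq> adj G (Z 0) (Suc (X (Suc i)))" if "i < m" "a2 \<noteq> a3" for i
      using c(9,10)[of 0 "Suc i"] that by simp
    show ?thesis
    proof (cases b1)
      case b1: True
      have Zi: "Z i < X i" if "i < m" for i using c(1)[of i "Suc i"] b1 that by simp
      consider "b2" | "\<not> b2" "b3" | "\<not> b2" "\<not> b3" by blast
      then show ?thesis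
      proof cases
        case 1
        \<comment> \<open>Every \<open>Z i\<close> lies left of its own pair by \<open>b1\<close>,
          left of earlier pairs by \<open>b2\<close>, and later pairs are further right.\<close>
        have L: "Z i < X j" if "i < m" "j < m" for i j
          using Zi[of i] c(2)[of j i] X[of i j] 1 that by (cases i j rule: linorder_cases) auto
        show ?thesis
        proof (cases "a2 = a3")
          case False
          show ?thesis
          proof (rule star_left)
            show "Z 0 < X (Suc i)" if "i < m" for i
              using c(1)[of 0 1] X[of 0 "Suc i"] b1 that by simp
          qed (use s False in blast)
        next
          case True
          show ?thesis
          proof (rule rich_matrix[of m G Z X "\<lambda>i. Suc (X i)" _ b6 True a2 a4])
            show "Z i < X j \<and> Z i < Suc (X j)" if "i < m" "j < m" for i j
              using L[OF that] by simp
            show "if True then a < b else b < a"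
              if "i < j" "j < m" "a \<in> {X i, Suc (X i)}" "b \<in> {X j, Suc (X j)}" for i j a b
              using X'[of i j a b] that by simp
            show "adj G (Z i) (X j) = a2 \<and> adj G (Z i) (Suc (X j)) = a2" if "i < j" "j < m" for i j
              using c(9,10)[of i j] that True by simp
            show "adj G (Z j) (X i) = a4" if "i < j" "j < m" for i j
              using c(11)[of i j] that by simp
          qed (use sep V b6 in auto)
        qed
      next
        case 2
        \<comment> \<open>For \<open>i < j\<close> now \<open>Suc (X i) < Z j\<close> and
          \<open>Z j < X j\<close>, so the triples follow one another.\<close>
        then have L: "Suc (X i) < Z j" if "i < j" "j < m" for i j using c(3)[of i j] that by simp
        show ?thesis
        proof (rule rich_local[of m G Z X "\<lambda>i. Suc (X i)" _ a1])
          fix i j a b assume ij: "i < j" "j < m"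
            and ab: "a \<in> {Z i, X i, Suc (X i)}" "b \<in> {Z j, X j, Suc (X j)}"
          have "a \<le> Suc (X i)" "Z j \<le> b" using Zi[of i] Zi[of j] ij ab by auto
          then show "a < b" using L[OF ij] by simp
        qed (use sep V Zi c in \<open>auto simp: less_SucI\<close>)
      next
        \<comment> \<open>\<open>Z 2\<close> would belong to both of the disjoint pairs at
          \<open>X 0\<close> and \<open>X 1\<close>.\<close>
        case 3
        then show ?thesis
          using c(2,3)[of 0 2] c(2,3)[of 1 2] X[of 0 1] by simp
      qed
    next
      case b1: False
      have Zi: "Suc (X i) < Z i" if "i < m" for i
        using c(1)[of i "Suc i"] Z[of i] b1 that by simp
      consider "b4" | "\<not> b4" "b5" | "\<not> b4" "\<not> b5" by blast
      then show ?thesis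
      proof cases
        case 1
        then have L: "Z i < X j" if "i < j" "j < m" for i j using c(4)[of i j] that by simp
        \<comment> \<open>Each \<open>Z i\<close> lies to the right of its pair and to the left of
          later pairs. In decreasing order it comes first in its triple, and reading the indices
          backwards puts the triples themselves in that order.\<close>
        let ?r = "\<lambda>i. m - Suc i"
        show ?thesis
        proof (rule rich_converse, rule rich_local[of m G "\<lambda>i. Z (?r i)" "\<lambda>i. X (?r i)" "\<lambda>i. Suc (X (?r i))" _ a1])
          fix i j a b assume ij: "i < j" "j < m"
            and ab: "a \<in> {Z (?r i), X (?r i), Suc (X (?r i))}" "b \<in> {Z (?r j), X (?r j), Suc (X (?r j))}"
          have r: "?r j < ?r i" "?r i < m" "?r j < m" using ij by auto
          have "X (?r i) \<le> a" "b \<le> Z (?r j)" using Zi[OF r(2)] Zi[OF r(3)] ab by auto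
          then show "b < a" using L[OF r(1,2)] by simp
        next
          fix i j assume ij: "i < j" "j < m"
          then show "adj G (Z (?r i)) (Z (?r j)) = a1"
            using c(8)[of "?r j" "?r i"] adj_commute[of G "Z (?r i)" "Z (?r j)"] by simp
        next
          fix i assume "i < m"
          then have r: "?r i < m" by simp
          show "X (?r i) < Z (?r i) \<and> Suc (X (?r i)) < Z (?r i)"
            using Zi[OF r] by simp
          show "{Z (?r i), X (?r i), Suc (X (?r i))} \<subseteq> {1..fst G}" using V[of "?r i"] r by simp
          show "adj G (Z (?r i)) (X (?r i)) \<noteq> adj G (Z (?r i)) (Suc (X (?r i)))"
            using sep[of "?r i"] r by simp
        qed
      next
        case 2
        have L: "Suc (X j) < Z i" if "i < m" "j < m" for i j
          using Zi[of i] c(5)[of i j] X[of j i] 2 that by (cases i j rule: linorder_cases) auto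
        show ?thesis
        proof (cases "a2 = a3")
          case False
          show ?thesis
            by (rule star_right) (use s False c(5)[of 0] 2 in auto)
        next
          case True
          show ?thesis
          \<comment> \<open>In decreasing order the columns run against their indices, hence
            \<open>False\<close>, and the direction of the rows is negated.\<close>
          proof (rule rich_converse, rule rich_matrix[of m G Z X "\<lambda>i. Suc (X i)" _ "\<not> b6" False a2 a4])
            show "X j < Z i \<and> Suc (X j) < Z i" if "i < m" "j < m" for i j
              using L[OF that] by simp
            show "if False then b < a else a < b"
              if "i < j" "j < m" "a \<in> {X i, Suc (X i)}" "b \<in> {X j, Suc (X j)}" for i j a b
              using X'[of i j a b] that by simp
            show "if \<not> b6 then Z j < Z i else Z i < Z j" if "i < j" "j < m" for i j
              using b6[OF that] by (simp split: if_splits)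
            show "adj G (Z i) (X j) = a2 \<and> adj G (Z i) (Suc (X j)) = a2" if "i < j" "j < m" for i j
              using c(9,10)[of i j] that True by simp
            show "adj G (Z j) (X i) = a4" if "i < j" "j < m" for i j
              using c(11)[of i j] that by simp
          qed (use sep V in auto)
        qed
      next
        \<comment> \<open>\<open>Z 0\<close> would belong to both of the disjoint pairs at
          \<open>X 1\<close> and \<open>X 2\<close>.\<close>
        case 3
        then show ?thesis
          using c(4,5)[of 0 1] c(4,5)[of 0 2] X[of 1 2] by simp
      qed
    qed
  qed
qed

lemma many_breaks_rich:
  "\<exists>N. \<forall>G. N \<le> card (breaks G) \<longrightarrow> rich (<) G m"
proof -
  obtain N :: nat where N: "\<And>col :: nat \<Rightarrow> nat \<Rightarrow> bool \<times> bool \<times> bool \<times> bool \<times> bool \<times> bool \<times> bool \<times> bool \<times> bool \<times> bool \<times> bool.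
      \<exists>h a. strict_mono_on {..<m + 3} h \<and> h ` {..<m + 3} \<subseteq> {..<N} \<and>
        (\<forall>i j. i < j \<longrightarrow> j < m + 3 \<longrightarrow> col (h i) (h j) = a)"
    using ramsey_finite_colours[where k = "m + 3"
        and 'c = "bool \<times> bool \<times> bool \<times> bool \<times> bool \<times> bool \<times> bool \<times> bool \<times> bool \<times> bool \<times> bool"]
    by blast
  have "rich (<) G m" if G: "2 * N \<le> card (breaks G)" for G
  proof -
    \<comment> \<open>Taking every second break makes the pairs \<open>{X i, Suc (X i)}\<close>
      disjoint, at the price of the factor 2 in \<open>2 * N\<close>.\<close>
    define X where "X i = sorted_list_of_set (breaks G) ! (2 * i)" for i
    have len: "length (sorted_list_of_set (breaks G)) = card (breaks G)" by simp
    have mono: "sorted_list_of_set (breaks G) ! i < sorted_list_of_set (breaks G) ! j"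
      if "i < j" "j < card (breaks G)" for i j
      using that strict_sorted_list_of_set[of "breaks G"] by (simp add: sorted_wrt_iff_nth_less)
    have Xbr: "X i \<in> breaks G" if "i < N" for i
      using nth_mem[of "2 * i" "sorted_list_of_set (breaks G)"] that G by (simp add: X_def)
    have Xlt: "Suc (X i) < X j" if "i < j" "j < N" for i j
      using mono[of "2 * i" "Suc (2 * i)"] mono[of "Suc (2 * i)" "2 * j"] that G by (simp add: X_def)
    have "\<exists>z\<in>{1..fst G} - {X i, Suc (X i)}. adj G z (X i) \<noteq> adj G z (Suc (X i))" if "i < N" for i
      using Xbr[OF that] by (simp add: breaks_def)
    then obtain Z where Z: "\<And>i. i < N \<Longrightarrow> Z i \<in> {1..fst G} - {X i, Suc (X i)} \<and>
        adj G (Z i) (X i) \<noteq> adj G (Z i) (Suc (X i))" by metis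
    define col where "col i j =
      (Z i < X i, Z j < X i, Suc (X i) < Z j, Z i < X j, Suc (X j) < Z i, Z i < Z j, Z i = Z j,
       adj G (Z i) (Z j), adj G (Z i) (X j), adj G (Z i) (Suc (X j)), adj G (Z j) (X i))" for i j
    obtain h a where h: "strict_mono_on {..<m + 3} h" "h ` {..<m + 3} \<subseteq> {..<N}"
      "\<And>i j. i < j \<Longrightarrow> j < m + 3 \<Longrightarrow> col (h i) (h j) = a"
      using N[of col] by blast
    have hN: "h i < N" if "i < m + 3" for i using h(2) that by auto
    have hlt: "h i < h j" if "i < j" "j < m + 3" for i j
      using h(1) that by (auto simp: strict_mono_on_def)
    obtain b1 b2 b3 b4 b5 b6 b7 a1 a2 a3 a4
      where a: "a = (b1, b2, b3, b4, b5, b6, b7, a1, a2, a3, a4)" by (metis prod.exhaust)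
    show ?thesis
    proof (rule rich_homogeneous_triples[of m "\<lambda>i. X (h i)" G "\<lambda>i. Z (h i)"])
      fix i assume i: "i < m + 3"
      show "1 \<le> X (h i) \<and> Suc (X (h i)) \<le> fst G" using Xbr[OF hN[OF i]] by (simp add: breaks_def)
      show "1 \<le> Z (h i) \<and> Z (h i) \<le> fst G \<and> Z (h i) \<noteq> X (h i) \<and> Z (h i) \<noteq> Suc (X (h i))"
        "adj G (Z (h i)) (X (h i)) \<noteq> adj G (Z (h i)) (Suc (X (h i)))"
        using Z[OF hN[OF i]] by auto
    next
      fix i j assume ij: "i < j" "j < m + 3"
      show "Suc (X (h i)) < X (h j)" by (rule Xlt[OF hlt[OF ij] hN[OF ij(2)]])
    qed (use h(3) in \<open>unfold col_def a\<close>)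
  qed
  then show ?thesis by blast
qed

theorem theorem13:
  fixes P :: "ograph set" and m :: nat
  assumes "hereditary P"
    and "card (slice P m) < fibF m"
  shows "\<exists>(K::nat) (N::nat) (a::nat \<Rightarrow> int).
           \<forall>n\<ge>N. int (card (slice P n)) = (\<Sum>i\<le>K. a i * int (n choose i))"
proof -
  obtain b where b: "\<And>G. b \<le> card (breaks G) \<Longrightarrow> rich (<) G m"
    using many_breaks_rich by blast
  have "card (breaks G) < b" if "G \<in> P" for G
    using rich_imp_fibF_le[OF assms(1) that] b[of G] assms(2) by fastforce
  then obtain k where "poly_diff k (\<lambda>n. int (card (slice P n)))"
    using bounded_breaks_eventually_poly[OF assms(1)] unfolding eventually_poly_def by blast
  then show ?thesis by (rule poly_diff_binomial)
qed

end
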